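(* Let $\delta,\epsilon\in(0,1)$, $r_0\in(0,\infty)$ and $C,D\in[1,\infty)$. If $(X,d,\mu)$ is a $(C,\delta,\epsilon,r_0)$-connected $(D,r_0)$-doubling metric measure space, then there exist $\alpha\in(0,\infty)$ and $C_1,C_2\in[1,\infty)$ such that $X$ is locally finely $(\alpha,r_0/(8C_1))$-connected with parameters $(C_1,C_2)$. One can choose $$\alpha=\frac{\ln\delta}{\ln\left(\frac{\epsilon}{2M}\right)},\qquad C_1=\frac{C}{1-\delta},\qquad C_2=\frac{2M}{\epsilon},\qquad\text{where } M=2D^{-\log_2(1-\delta)+4}.$$
   Context: Standing assumptions: metric measure spaces $(X,d,\mu)$ are complete and separable, $\mu$ is a Radon measure, and $0<\mu(B(x,r))<\infty$ for all open balls. $(D,r_0)$-doubling: $\mu(B(x,2r))\le D\,\mu(B(x,r))$ for all $x\in X$, $r\in(0,r_0)$. Connectivity: a curve fragment is a Lipschitz map $\gamma:K\to X$ with $K\subset\mathbb{R}$ compact; it connects $x$ and $y$ if $\gamma(\min K)=x$, $\gamma(\max K)=y$. Writing $[\min K,\max K]\setminus K=\bigcup_i(a_i,b_i)$ with disjoint maximal open intervals, set $\mathrm{gap}(\gamma)=\sum_i d(\gamma(a_i),\gamma(b_i))$; set $\mathrm{len}(\gamma)=\sup\sum_i d(\gamma(t_{i+1}),\gamma(t_i))$ over finite sequences $t_1\le\dots\le t_n$ in $K$. For $C\ge1$, $\delta>0$, $0<\epsilon<1$, a pair $(x,y)$ with $r=d(x,y)>0$ is $(C,\delta,\epsilon)$-connected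 if for every Borel set $E$ with $\mu(E\cap B(x,Cr))<\epsilon\mu(B(x,Cr))$ there is a curve fragment $\gamma:K\to X$ connecting $x$ and $y$ with $\mathrm{len}(\gamma)\le C d(x,y)$, $\mathrm{gap}(\gamma)<\delta d(x,y)$ and $\gamma^{-1}(E)\subset\{\min K,\max K\}$. $X$ is $(C,\delta,\epsilon,r_0)$-connected if every pair with $0<d(x,y)\le r_0$ is $(C,\delta,\epsilon)$-connected. Fine connectivity: $X$ is locally finely $(\alpha,r_1)$-connected with parameters $(C_1,C_2)$ if for every $0<\tau<1$ it is $(C_1,C_2\tau^\alpha,\tau,r_1)$-connected. *)

theory Defs
  imports "HOL-Analysis.Analysis"
begin

(* The class polish_space (complete metric, second countable) expresses that the underlying
   metric space is complete and separable. *)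

definition radon_measure :: "'a::polish_space measure \<Rightarrow> bool" where
  "radon_measure \<mu> \<longleftrightarrow>
     sets \<mu> = sets borel \<and>
     (\<forall>x. \<exists>U. open U \<and> x \<in> U \<and> emeasure \<mu> U < \<infinity>) \<and>
     (\<forall>E\<in>sets borel. emeasure \<mu> E = (SUP K\<in>{K. compact K \<and> K \<subseteq> E}. emeasure \<mu> K))"

definition metric_measure_space :: "'a::polish_space measure \<Rightarrow> bool" where
  "metric_measure_space \<mu> \<longleftrightarrow>
     radon_measure \<mu> \<and>
     (\<forall>x r. r > 0 \<longrightarrow> 0 < emeasure \<mu> (ball x r) \<and> emeasure \<mu> (ball x r) < \<infinity>)"

definition doubling :: "'a::polish_space measure \<Rightarrow> real \<Rightarrow> real \<Rightarrow> bool" where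
  "doubling \<mu> D r0 \<longleftrightarrow>
     (\<forall>x. \<forall>r\<in>{0<..<r0}. emeasure \<mu> (ball x (2 * r)) \<le> ennreal D * emeasure \<mu> (ball x r))"

(* A curve fragment is a pair of a domain K and a function on the reals of which only the values
   on K matter. As K is compact and nonempty, Inf K and Sup K are min K and max K. *)

definition curve_fragment :: "real set \<Rightarrow> (real \<Rightarrow> 'a::metric_space) \<Rightarrow> bool" where
  "curve_fragment K \<gamma> \<longleftrightarrow> compact K \<and> K \<noteq> {} \<and> (\<exists>L. L-lipschitz_on K \<gamma>)"

definition fragment_connects :: "real set \<Rightarrow> (real \<Rightarrow> 'a::metric_space) \<Rightarrow> 'a \<Rightarrow> 'a \<Rightarrow> bool" where
  "fragment_connects K \<gamma> x y \<longleftrightarrow> \<gamma> (Inf K) = x \<and> \<gamma> (Sup K) = y"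

(* The maximal open intervals contained in [min K, max K] - K, given by their endpoints. *)
definition gap_intervals :: "real set \<Rightarrow> (real \<times> real) set" where
  "gap_intervals K =
     {(a, b). a < b \<and> {a<..<b} \<subseteq> {Inf K..Sup K} - K \<and>
        (\<forall>c d. {a<..<b} \<subseteq> {c<..<d} \<and> {c<..<d} \<subseteq> {Inf K..Sup K} - K \<longrightarrow> c = a \<and> d = b)}"

(* Both quantities are extended nonnegative: there the possibly infinite sum always exists and
   the supremum is meaningful without a boundedness proof. *)

definition fragment_gap :: "real set \<Rightarrow> (real \<Rightarrow> 'a::metric_space) \<Rightarrow> ennreal" where
  "fragment_gap K \<gamma> = (\<Sum>\<^sub>\<infinity>(a, b)\<in>gap_intervals K. ennreal (dist (\<gamma> a) (\<gamma> b)))"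

definition fragment_len :: "real set \<Rightarrow> (real \<Rightarrow> 'a::metric_space) \<Rightarrow> ennreal" where
  "fragment_len K \<gamma> =
     (SUP ts\<in>{ts. sorted ts \<and> set ts \<subseteq> K}.
        ennreal (\<Sum>i<length ts - 1. dist (\<gamma> (ts ! Suc i)) (\<gamma> (ts ! i))))"

definition fragment_connected_pair ::
    "'a::polish_space measure \<Rightarrow> real \<Rightarrow> real \<Rightarrow> real \<Rightarrow> 'a \<Rightarrow> 'a \<Rightarrow> bool" where
  "fragment_connected_pair \<mu> C \<delta> \<epsilon> x y \<longleftrightarrow>
     (\<forall>E\<in>sets borel.
        emeasure \<mu> (E \<inter> ball x (C * dist x y)) < ennreal \<epsilon> * emeasure \<mu> (ball x (C * dist x y)) \<longrightarrow>
        (\<exists>K \<gamma>. curve_fragment K \<gamma> \<and> fragment_connects K \<gamma> x y \<and>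
           fragment_len K \<gamma> \<le> ennreal (C * dist x y) \<and>
           fragment_gap K \<gamma> < ennreal (\<delta> * dist x y) \<and>
           {t\<in>K. \<gamma> t \<in> E} \<subseteq> {Inf K, Sup K}))"

definition fragment_connected_space ::
    "'a::polish_space measure \<Rightarrow> real \<Rightarrow> real \<Rightarrow> real \<Rightarrow> real \<Rightarrow> bool" where
  "fragment_connected_space \<mu> C \<delta> \<epsilon> r0 \<longleftrightarrow>
     (\<forall>x y. 0 < dist x y \<and> dist x y \<le> r0 \<longrightarrow> fragment_connected_pair \<mu> C \<delta> \<epsilon> x y)"

definition locally_finely_connected ::
    "'a::polish_space measure \<Rightarrow> real \<Rightarrow> real \<Rightarrow> real \<Rightarrow> real \<Rightarrow> bool" where
  "locally_finely_connected \<mu> \<alpha> r1 C1 C2 \<longleftrightarrow>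
     (\<forall>\<tau>. 0 < \<tau> \<and> \<tau> < 1 \<longrightarrow> fragment_connected_space \<mu> C1 (C2 * \<tau> powr \<alpha>) \<tau> r1)"

end

theory Submission
  imports Defs
begin

text \<open>The connectivity assumption is improved by applying it again inside the gaps of the fragments
  that it provides.  Put \<open>q = \<epsilon> / (2 * M)\<close> and \<open>C1 = C / (1 - \<delta>)\<close>.  By induction on \<open>n\<close>, whenever
  \<open>E\<close> has density below \<open>q ^ n\<close> in the ball of radius \<open>C1 * dist x y\<close> around \<open>x\<close>, some fragment from
  \<open>x\<close> to \<open>y\<close> avoids \<open>E\<close> except at its ends, has length at most \<open>C1 * dist x y\<close> and gaps of total size at most
  \<open>\<delta> ^ n * dist x y\<close> (\<open>joined_if_sparse_power\<close>).

  For \<open>n = 0\<close> the jump from \<open>x\<close> to \<open>y\<close> will do.  For the step, the points around which \<open>E\<close> has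
  density at least \<open>q ^ n\<close> at some relevant scale are covered by a set that is itself sparse: this is
  the weak type estimate for the maximal function, which in a doubling space follows from a Vitali
  covering (\<open>exceptional_set\<close>).  The assumption then gives a fragment that avoids this set and \<open>E\<close>
  and whose gaps sum to less than \<open>\<delta> * dist x y\<close>.  Each gap has an end outside the exceptional set,
  so that the induction hypothesis applies to the gap and shrinks it by the factor \<open>\<delta> ^ n\<close>
  (\<open>joined_if_sparse_Suc\<close>).

  Two points need care.  Filling infinitely many gaps could destroy the Lipschitz property; as the
  bound on the total gap is strict, it suffices to fill finitely many of them (\<open>fragment_refine\<close>).
  And to pass from the densities \<open>q ^ n\<close> to an arbitrary \<open>\<tau>\<close> one needs \<open>q < \<delta>\<close>.  This is a consequence
  of connectivity: an annulus of small measure around \<open>x\<close> can be used as \<open>E\<close>, and a fragment from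
  \<open>x\<close> to \<open>y\<close> has to jump across it (\<open>fragment_connected_pair_gap_gt\<close>).\<close>

section \<open>Gaps and lengths of curve fragments\<close>

lemma compact_Inf_Sup:
  fixes K :: "real set"
  assumes "compact K" "K \<noteq> {}"
  shows "Inf K \<in> K" "Sup K \<in> K" "\<And>t. t \<in> K \<Longrightarrow> Inf K \<le> t \<and> t \<le> Sup K"
proof -
  have bd: "bdd_below K" "bdd_above K"
    using compact_imp_bounded[OF assms(1)]
    by (simp_all add: bounded_imp_bdd_below bounded_imp_bdd_above)
  show "Inf K \<in> K" "Sup K \<in> K"
    using assms closed_contains_Inf closed_contains_Sup compact_imp_closed bd by blast+
  show "Inf K \<le> t \<and> t \<le> Sup K" if "t \<in> K" for t
    using bd that by (simp add: cInf_lower cSup_upper)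
qed

text \<open>The gaps are the pairs of consecutive points of \<open>K\<close>: an endpoint outside the closed set
  \<open>K\<close> would have a neighbourhood outside \<open>K\<close> as well, and the interval could be enlarged.\<close>

lemma gap_intervals_iff:
  assumes K: "compact K" "K \<noteq> {}"
  shows "(a, b) \<in> gap_intervals K \<longleftrightarrow> a < b \<and> a \<in> K \<and> b \<in> K \<and> {a<..<b} \<inter> K = {}"
    (is "?L \<longleftrightarrow> ?R")
proof
  note I = compact_Inf_Sup[OF K]
  assume ?L
  then have ab: "a < b" and sub: "{a<..<b} \<subseteq> {Inf K..Sup K} - K"
    and mx: "\<And>c d. {a<..<b} \<subseteq> {c<..<d} \<Longrightarrow> {c<..<d} \<subseteq> {Inf K..Sup K} - K \<Longrightarrow> c = a \<and> d = b"
    unfolding gap_intervals_def by auto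
  have ends: "Inf K \<le> a" "b \<le> Sup K"
  proof -
    have "{a<..<b} \<subseteq> {Inf K..Sup K}"
      using sub by auto
    then show "Inf K \<le> a" "b \<le> Sup K"
      using ab greaterThanLessThan_subseteq_atLeastAtMost_iff by blast+
  qed
  have opn: "open (- K)"
    using K(1) by (simp add: compact_imp_closed open_Compl)
  have "a \<in> K"
  proof (rule ccontr)
    assume na: "a \<notin> K"
    then obtain e where e: "e > 0" "ball a e \<subseteq> - K"
      using opn unfolding open_contains_ball by blast
    have lt: "Inf K < a"
      using ends I(1) na by (metis order_le_less)
    define c where "c = max (Inf K) (a - e)"
    have c: "c < a" "Inf K \<le> c" "a - e \<le> c"
      using lt e(1) by (auto simp: c_def)
    have "{c<..<b} \<subseteq> {Inf K..Sup K} - K"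
    proof
      fix t assume t: "t \<in> {c<..<b}"
      show "t \<in> {Inf K..Sup K} - K"
      proof (cases "t \<le> a")
        case True
        then have "t \<in> ball a e"
          using t c by (auto simp: dist_real_def)
        then show ?thesis
          using e(2) t c ends by auto
      next
        case False
        then have "t \<in> {a<..<b}"
          using t by auto
        then show ?thesis
          using sub by blast
      qed
    qed
    moreover have "{a<..<b} \<subseteq> {c<..<b}"
      using c(1) by force
    ultimately have "c = a"
      using mx[of c b] by blast
    then show False
      using c(1) by simp
  qed
  moreover have "b \<in> K"
  proof (rule ccontr)
    assume nb: "b \<notin> K"
    then obtain e where e: "e > 0" "ball b e \<subseteq> - K"
      using opn unfolding open_contains_ball by blast
    have lt: "b < Sup K"
      using ends I(2) nb by (metis order_le_less)
    define c where "c = min (Sup K) (b + e)"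
    have c: "b < c" "c \<le> Sup K" "c \<le> b + e"
      using lt e(1) by (auto simp: c_def)
    have "{a<..<c} \<subseteq> {Inf K..Sup K} - K"
    proof
      fix t assume t: "t \<in> {a<..<c}"
      show "t \<in> {Inf K..Sup K} - K"
      proof (cases "b \<le> t")
        case True
        then have "t \<in> ball b e"
          using t c by (auto simp: dist_real_def)
        then show ?thesis
          using e(2) t c ends by auto
      next
        case False
        then have "t \<in> {a<..<b}"
          using t by auto
        then show ?thesis
          using sub by blast
      qed
    qed
    moreover have "{a<..<b} \<subseteq> {a<..<c}"
      using c(1) by force
    ultimately have "c = b"
      using mx[of a c] by blast
    then show False
      using c(1) by simp
  qed
  ultimately show ?R
    using ab sub by auto
next
  note I = compact_Inf_Sup[OF K]
  assume R: ?R
  have 1: "{a<..<b} \<subseteq> {Inf K..Sup K} - K"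
    using R I(3)[of a] I(3)[of b] by force
  have 2: "c = a \<and> d = b" if s: "{a<..<b} \<subseteq> {c<..<d}" "{c<..<d} \<subseteq> {Inf K..Sup K} - K" for c d
  proof -
    have cd: "c \<le> a" "b \<le> d"
      using s(1) R greaterThanLessThan_subseteq_greaterThanLessThan by blast+
    have "a \<notin> {c<..<d}" "b \<notin> {c<..<d}"
      using s(2) R by blast+
    then show ?thesis
      using cd R by auto
  qed
  show ?L
    unfolding gap_intervals_def using R 1 2 by blast
qed

lemma infsum_ennreal_subset_mono:
  fixes f :: "'b \<Rightarrow> ennreal"
  assumes "A \<subseteq> B"
  shows "infsum f A \<le> infsum f B"
  by (rule infsum_mono_neutral) (use assms in \<open>auto intro: nonneg_summable_on_complete\<close>)

lemma infsum_ennreal_Un_le: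
  fixes f :: "'b \<Rightarrow> ennreal"
  shows "infsum f (A \<union> B) \<le> infsum f A + infsum f B"
proof -
  have "infsum f (A \<union> B) = infsum f (A \<union> (B - A))"
    by simp
  also have "\<dots> = infsum f A + infsum f (B - A)"
    by (rule infsum_Un_disjoint) (auto intro: nonneg_summable_on_complete)
  also have "\<dots> \<le> infsum f A + infsum f B"
    by (intro add_left_mono infsum_ennreal_subset_mono) auto
  finally show ?thesis .
qed

text \<open>Length is handled through a length function \<open>v\<close>: a running total along \<open>K\<close> that increases
  by at least the distance covered.  The supremum over partitions then never has to be cut at the
  points where fragments are glued, since length functions are glued by adding constants.\<close>

lemma fragment_len_le_iff:
  fixes \<gamma> :: "real \<Rightarrow> 'a::metric_space"
  assumes "0 \<le> l"
  shows "fragment_len K \<gamma> \<le> ennreal l \<longleftrightarrow>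
    (\<exists>v. (\<forall>t\<in>K. 0 \<le> v t \<and> v t \<le> l) \<and>
         (\<forall>s\<in>K. \<forall>t\<in>K. s \<le> t \<longrightarrow> dist (\<gamma> s) (\<gamma> t) \<le> v t - v s))" (is "?L \<longleftrightarrow> ?R")
proof
  assume L: ?L
  define p where "p ts = (\<Sum>i<length ts - 1. dist (\<gamma> (ts ! Suc i)) (\<gamma> (ts ! i)))" for ts
  have p_le: "p ts \<le> l" if "sorted ts" "set ts \<subseteq> K" for ts
  proof -
    have "ennreal (p ts) \<le> fragment_len K \<gamma>"
      unfolding fragment_len_def p_def by (rule SUP_upper) (use that in auto)
    also note L
    finally show ?thesis
      using assms by (simp add: ennreal_le_iff)
  qed
  define S where "S t = {ts. sorted ts \<and> set ts \<subseteq> K \<inter> {..t}}" for t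
  define v where "v t = (SUP ts\<in>S t. p ts)" for t
  have ne: "[] \<in> S t" for t
    by (simp add: S_def)
  have bdd: "bdd_above (p ` S t)" for t
    by (rule bdd_aboveI2[where M = l]) (auto simp: S_def p_le)
  have "0 \<le> v t \<and> v t \<le> l" for t
  proof
    have "p [] \<le> v t"
      unfolding v_def by (rule cSUP_upper[OF ne bdd])
    then show "0 \<le> v t"
      by (simp add: p_def)
    show "v t \<le> l"
      unfolding v_def
    proof (rule cSUP_least)
      show "S t \<noteq> {}"
        using ne by blast
    qed (auto simp: S_def p_le)
  qed
  moreover have "dist (\<gamma> s) (\<gamma> t) \<le> v t - v s" if st: "s \<in> K" "t \<in> K" "s \<le> t" for s t
  proof -
    have "p ts + dist (\<gamma> s) (\<gamma> t) \<le> v t" if ts: "ts \<in> S s" for ts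
    proof -
      define us where "us = ts @ [s, t]"
      have us: "us \<in> S t"
        using ts st by (force simp: us_def S_def sorted_append)
      have n: "{..<length us - 1} = insert (length ts) {..<length ts}"
        by (auto simp: us_def)
      have "p us = dist (\<gamma> t) (\<gamma> s) + (\<Sum>i<length ts. dist (\<gamma> (us ! Suc i)) (\<gamma> (us ! i)))"
        unfolding p_def n by (simp add: us_def nth_append)
      moreover have "p ts \<le> (\<Sum>i<length ts. dist (\<gamma> (us ! Suc i)) (\<gamma> (us ! i)))"
      proof -
        have "p ts = (\<Sum>i<length ts - 1. dist (\<gamma> (us ! Suc i)) (\<gamma> (us ! i)))"
          unfolding p_def by (rule sum.cong) (auto simp: us_def nth_append)
        also have "\<dots> \<le> (\<Sum>i<length ts. dist (\<gamma> (us ! Suc i)) (\<gamma> (us ! i)))"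
          by (rule sum_mono2) auto
        finally show ?thesis .
      qed
      moreover have "p us \<le> v t"
        unfolding v_def by (rule cSUP_upper[OF us bdd])
      ultimately show ?thesis
        by (simp add: dist_commute)
    qed
    then have "v s \<le> v t - dist (\<gamma> s) (\<gamma> t)"
      unfolding v_def[of s]
    proof (intro cSUP_least)
      show "S s \<noteq> {}"
        using ne by blast
    qed (auto simp: algebra_simps)
    then show ?thesis
      by simp
  qed
  ultimately show ?R
    by blast
next
  assume ?R
  then obtain v where v: "\<And>t. t \<in> K \<Longrightarrow> 0 \<le> v t \<and> v t \<le> l"
    "\<And>s t. s \<in> K \<Longrightarrow> t \<in> K \<Longrightarrow> s \<le> t \<Longrightarrow> dist (\<gamma> s) (\<gamma> t) \<le> v t - v s"
    by blast
  have "(\<Sum>i<length ts - 1. dist (\<gamma> (ts ! Suc i)) (\<gamma> (ts ! i))) \<le> l"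
    if ts: "sorted ts" "set ts \<subseteq> K" for ts
  proof (cases "ts = []")
    case False
    have "(\<Sum>i<length ts - 1. dist (\<gamma> (ts ! Suc i)) (\<gamma> (ts ! i)))
        \<le> (\<Sum>i<length ts - 1. v (ts ! Suc i) - v (ts ! i))"
    proof (rule sum_mono)
      fix i assume "i \<in> {..<length ts - 1}"
      then have i: "i < length ts" "Suc i < length ts"
        by auto
      then have "ts ! i \<in> K" "ts ! Suc i \<in> K" "ts ! i \<le> ts ! Suc i"
        using ts nth_mem by (auto simp: sorted_nth_mono)
      then show "dist (\<gamma> (ts ! Suc i)) (\<gamma> (ts ! i)) \<le> v (ts ! Suc i) - v (ts ! i)"
        using v(2) by (simp add: dist_commute)
    qed
    also have "\<dots> = v (ts ! (length ts - 1)) - v (ts ! 0)"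
      by (rule sum_lessThan_telescope)
    also have "\<dots> \<le> l"
    proof -
      have "ts ! (length ts - 1) \<in> K" "ts ! 0 \<in> K"
        using False ts(2) nth_mem by (auto simp: subset_iff)
      then show ?thesis
        using v(1) by (smt (verit))
    qed
    finally show ?thesis .
  qed (use assms in simp)
  then show ?L
    unfolding fragment_len_def by (intro SUP_least ennreal_leI) auto
qed

lemma dist_le_fragment_len:
  assumes "fragment_len K \<gamma> \<le> ennreal l" "0 \<le> l" "s \<in> K" "t \<in> K"
  shows "dist (\<gamma> s) (\<gamma> t) \<le> l"
proof -
  obtain v where v: "\<And>t. t \<in> K \<Longrightarrow> 0 \<le> v t \<and> v t \<le> l"
    "\<And>s t. s \<in> K \<Longrightarrow> t \<in> K \<Longrightarrow> s \<le> t \<Longrightarrow> dist (\<gamma> s) (\<gamma> t) \<le> v t - v s"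
    using assms(1) unfolding fragment_len_le_iff[OF assms(2)] by blast
  show ?thesis
    using v(1)[of s] v(1)[of t] v(2)[of s t] v(2)[of t s] assms(3,4)
    by (cases "s \<le> t") (auto simp: dist_commute)
qed

lemma dist_le_fragment_gap:
  assumes "(a, b) \<in> gap_intervals K"
  shows "ennreal (dist (\<gamma> a) (\<gamma> b)) \<le> fragment_gap K \<gamma>"
proof -
  have "infsum (\<lambda>(a, b). ennreal (dist (\<gamma> a) (\<gamma> b))) {(a, b)} \<le> fragment_gap K \<gamma>"
    unfolding fragment_gap_def by (rule infsum_ennreal_subset_mono) (use assms in auto)
  then show ?thesis
    by simp
qed

section \<open>Joining two points by a fragment with prescribed bounds\<close>

definition fragment_avoids :: "'a set \<Rightarrow> real set \<Rightarrow> (real \<Rightarrow> 'a) \<Rightarrow> bool" where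
  "fragment_avoids E K \<gamma> \<longleftrightarrow> {t\<in>K. \<gamma> t \<in> E} \<subseteq> {Inf K, Sup K}"

text \<open>The least and greatest parameters \<open>a\<close> and \<open>b\<close> are recorded because a fragment that is to fill a
  gap must be parametrised by exactly that gap.\<close>

definition joined_on :: "real \<Rightarrow> real \<Rightarrow> 'a::metric_space set \<Rightarrow> 'a \<Rightarrow> 'a \<Rightarrow> real \<Rightarrow> real \<Rightarrow> bool" where
  "joined_on a b E x y l g \<longleftrightarrow>
     (\<exists>K \<gamma>. curve_fragment K \<gamma> \<and> fragment_connects K \<gamma> x y \<and>
        fragment_len K \<gamma> \<le> ennreal l \<and> fragment_gap K \<gamma> \<le> ennreal g \<and>
        fragment_avoids E K \<gamma> \<and> Inf K = a \<and> Sup K = b)"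

text \<open>The factor \<open>c\<close> may be negative, so this covers both rescaling of the parameter and
  reversal of the direction.\<close>

lemma joined_on_affine:
  fixes a b c e :: real
  assumes J: "joined_on a b E x y l g" and "0 \<le> l" and c: "c \<noteq> 0"
  shows "if c > 0 then joined_on (c * a + e) (c * b + e) E x y l g
         else joined_on (c * b + e) (c * a + e) E y x l g"
proof -
  obtain K \<gamma> where K: "compact K" "K \<noteq> {}" and L: "\<exists>L. L-lipschitz_on K \<gamma>"
    and xy: "\<gamma> a = x" "\<gamma> b = y" and len: "fragment_len K \<gamma> \<le> ennreal l"
    and gap: "fragment_gap K \<gamma> \<le> ennreal g" and av: "{t\<in>K. \<gamma> t \<in> E} \<subseteq> {a, b}"
    and ab: "Inf K = a" "Sup K = b"
    using J unfolding joined_on_def curve_fragment_def fragment_connects_def fragment_avoids_def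
    by auto
  note I = compact_Inf_Sup[OF K, unfolded ab]
  define h where "h t = c * t + e" for t
  define k where "k t = (t - e) / c" for t
  have kh [simp]: "k (h t) = t" "h (k t) = t" for t
    using c by (auto simp: h_def k_def)
  define K' where "K' = h ` K"
  define \<gamma>' where "\<gamma>' = \<gamma> \<circ> k"
  have K': "compact K'" "K' \<noteq> {}"
    unfolding K'_def h_def using K by (auto intro!: compact_continuous_image continuous_intros)
  have mono: "h s \<le> h t \<longleftrightarrow> s \<le> t" "h s < h t \<longleftrightarrow> s < t" if "c > 0" for s t
    using that by (auto simp: h_def)
  have anti: "h s \<le> h t \<longleftrightarrow> t \<le> s" "h s < h t \<longleftrightarrow> t < s" if "c < 0" for s t
    using that by (auto simp: h_def)
  have ends: "Inf K' = (if c > 0 then h a else h b)" "Sup K' = (if c > 0 then h b else h a)"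
  proof -
    have "Inf K' = h a \<and> Sup K' = h b" if "c > 0"
      unfolding K'_def using I mono[OF that]
      by (intro conjI cInf_eq_minimum cSup_eq_maximum) auto
    moreover have "Inf K' = h b \<and> Sup K' = h a" if "c < 0"
      unfolding K'_def using I anti[OF that]
      by (intro conjI cInf_eq_minimum cSup_eq_maximum) auto
    ultimately show "Inf K' = (if c > 0 then h a else h b)" "Sup K' = (if c > 0 then h b else h a)"
      using c by (auto simp: not_less)
  qed
  have lip: "\<exists>L. L-lipschitz_on K' \<gamma>'"
  proof -
    obtain L where "L-lipschitz_on K \<gamma>"
      using L by blast
    moreover have "k ` K' = K"
      by (auto simp: K'_def image_image)
    moreover have "\<bar>1/c\<bar>-lipschitz_on K' k"
      by (rule lipschitz_onI)
        (auto simp: k_def dist_real_def abs_divide diff_divide_distrib[symmetric])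
    ultimately show ?thesis
      unfolding \<gamma>'_def using lipschitz_on_compose by metis
  qed
  have len': "fragment_len K' \<gamma>' \<le> ennreal l"
  proof -
    obtain v where v: "\<And>t. t \<in> K \<Longrightarrow> 0 \<le> v t \<and> v t \<le> l"
      "\<And>s t. s \<in> K \<Longrightarrow> t \<in> K \<Longrightarrow> s \<le> t \<Longrightarrow> dist (\<gamma> s) (\<gamma> t) \<le> v t - v s"
      using len unfolding fragment_len_le_iff[OF \<open>0 \<le> l\<close>] by blast
    define w where "w t = (if c > 0 then v (k t) else l - v (k t))" for t
    have "\<forall>t\<in>K'. 0 \<le> w t \<and> w t \<le> l"
      using v(1) by (auto simp: K'_def w_def)
    moreover have "\<forall>s\<in>K'. \<forall>t\<in>K'. s \<le> t \<longrightarrow> dist (\<gamma>' s) (\<gamma>' t) \<le> w t - w s"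
    proof (cases "c > 0")
      case True
      then show ?thesis
        using v(2) by (auto simp: K'_def w_def \<gamma>'_def mono)
    next
      case False
      then have "c < 0"
        using c by simp
      then show ?thesis
        using v(2) by (auto simp: K'_def w_def \<gamma>'_def anti) (metis dist_commute)
    qed
    ultimately show ?thesis
      unfolding fragment_len_le_iff[OF \<open>0 \<le> l\<close>] by blast
  qed
  have gap': "fragment_gap K' \<gamma>' \<le> ennreal g"
  proof -
    define G where "G = (\<lambda>(s, t). if c > 0 then (h s, h t) else (h t, h s))"
    have inj: "inj_on G (gap_intervals K)"
      by (rule inj_onI) (auto simp: G_def split: if_splits prod.splits; metis kh(1))
    have im: "gap_intervals K' \<subseteq> G ` gap_intervals K"
    proof (rule subrelI)
      fix s t assume "(s, t) \<in> gap_intervals K'"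
      then have st: "s < t" "s \<in> K'" "t \<in> K'" "{s<..<t} \<inter> K' = {}"
        unfolding gap_intervals_iff[OF K'] by auto
      obtain s0 t0 where s0: "s = h s0" "s0 \<in> K" and t0: "t = h t0" "t0 \<in> K"
        using st by (auto simp: K'_def)
      have none: "\<not> (h s0 < h u \<and> h u < h t0)" if "u \<in> K" for u
        using st(4) that by (auto simp: K'_def s0 t0)
      show "(s, t) \<in> G ` gap_intervals K"
      proof (cases "c > 0")
        case True
        have "(s0, t0) \<in> gap_intervals K"
          unfolding gap_intervals_iff[OF K]
          using none st(1) s0 t0 mono[OF True] by auto
        then show ?thesis
          by (rule rev_image_eqI) (use True in \<open>auto simp: G_def s0 t0\<close>)
      next
        case False
        then have "c < 0"
          using c by simp
        have "(t0, s0) \<in> gap_intervals K"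
          unfolding gap_intervals_iff[OF K]
          using none st(1) s0 t0 anti[OF \<open>c < 0\<close>] by auto
        then show ?thesis
          by (rule rev_image_eqI) (use False in \<open>auto simp: G_def s0 t0\<close>)
      qed
    qed
    have "fragment_gap K' \<gamma>' \<le> infsum (\<lambda>(s, t). ennreal (dist (\<gamma>' s) (\<gamma>' t))) (G ` gap_intervals K)"
      unfolding fragment_gap_def by (rule infsum_ennreal_subset_mono[OF im])
    also have "\<dots> = fragment_gap K \<gamma>"
      unfolding fragment_gap_def infsum_reindex[OF inj]
      by (rule infsum_cong) (auto simp: G_def \<gamma>'_def dist_commute split: prod.splits)
    also note gap
    finally show ?thesis .
  qed
  have frag: "curve_fragment K' \<gamma>'"
    using K' lip by (simp add: curve_fragment_def)
  have av': "{t\<in>K'. \<gamma>' t \<in> E} \<subseteq> {h a, h b}"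
    using av by (auto simp: K'_def \<gamma>'_def)
  have vals: "\<gamma>' (h a) = x" "\<gamma>' (h b) = y"
    using xy by (auto simp: \<gamma>'_def)
  show ?thesis
  proof (cases "c > 0")
    case True
    then have "joined_on (h a) (h b) E x y l g"
      unfolding joined_on_def fragment_connects_def fragment_avoids_def
      by (intro exI[of _ K'] exI[of _ \<gamma>']) (use frag av' vals ends len' gap' in auto)
    then show ?thesis
      using True by (simp add: h_def)
  next
    case False
    then have "joined_on (h b) (h a) E y x l g"
      unfolding joined_on_def fragment_connects_def fragment_avoids_def
      by (intro exI[of _ K'] exI[of _ \<gamma>']) (use frag av' vals ends len' gap' in auto)
    then show ?thesis
      using False by (simp add: h_def)
  qed
qed

lemma joined_on_rescale:
  assumes "joined_on a b E x y l g" "0 \<le> l" "a < b" "a' < b'"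
  shows "joined_on a' b' E x y l g" "joined_on a' b' E y x l g"
proof -
  define c where "c = (b' - a') / (b - a)"
  have c: "c > 0" "c * (b - a) = b' - a'"
    using assms by (auto simp: c_def)
  then have b': "b' = c * b - c * a + a'"
    by (simp add: algebra_simps)
  show "joined_on a' b' E x y l g"
    using joined_on_affine[OF assms(1,2), of c "a' - c * a"] c(1) by (simp add: b' algebra_simps)
  show "joined_on a' b' E y x l g"
    using joined_on_affine[OF assms(1,2), of "- c" "a' + c * b"] c(1)
    by (simp add: b' algebra_simps)
qed

text \<open>Two isolated parameters make one gap, so that the jump from \<open>x\<close> to \<open>y\<close> is itself a
  fragment.\<close>

lemma joined_on_jump:
  fixes a b :: real
  assumes "a < b"
  shows "joined_on a b E x y (dist x y) (dist x y)"
proof -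
  define \<gamma> where "\<gamma> t = (if t = a then x else y)" for t
  have K: "compact {a, b}" "{a, b} \<noteq> {}"
    by auto
  have gaps: "gap_intervals {a, b} \<subseteq> {(a, b)}"
    by (rule subrelI) (use assms in \<open>auto simp: gap_intervals_iff[OF K]\<close>)
  have ends: "Inf {a, b} = a" "Sup {a, b} = b"
    using assms by (auto intro!: cInf_eq_minimum cSup_eq_maximum)
  have "fragment_gap {a, b} \<gamma> \<le> infsum (\<lambda>(s, t). ennreal (dist (\<gamma> s) (\<gamma> t))) {(a, b)}"
    unfolding fragment_gap_def by (rule infsum_ennreal_subset_mono[OF gaps])
  then have gap: "fragment_gap {a, b} \<gamma> \<le> ennreal (dist x y)"
    using assms by (simp add: \<gamma>_def)
  have len: "fragment_len {a, b} \<gamma> \<le> ennreal (dist x y)"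
    unfolding fragment_len_le_iff[OF zero_le_dist]
    by (rule exI[of _ "\<lambda>t. if t = a then 0 else dist x y"]) (use assms in \<open>auto simp: \<gamma>_def\<close>)
  have "(dist x y / (b - a))-lipschitz_on {a, b} \<gamma>"
    by (rule lipschitz_onI) (use assms in \<open>auto simp: \<gamma>_def dist_real_def dist_commute\<close>)
  then have "curve_fragment {a, b} \<gamma>"
    unfolding curve_fragment_def using K by blast
  moreover have "fragment_connects {a, b} \<gamma> x y"
    using assms by (simp add: fragment_connects_def ends \<gamma>_def)
  moreover have "fragment_avoids E {a, b} \<gamma>"
    unfolding fragment_avoids_def ends by auto
  ultimately show ?thesis
    unfolding joined_on_def using gap len ends by blast
qed

section \<open>Filling finitely many gaps\<close>

text \<open>The gap \<open>(a, b)\<close> is replaced by the fragment \<open>\<gamma>0\<close>.  Since \<open>K\<close> and \<open>K0\<close> share just the points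
  \<open>a\<close> and \<open>b\<close>, where the values agree, every estimate across the seam passes through one of them,
  and neither set spoils a gap of the other.  Avoidance of \<open>E\<close> survives because the seam consists of
  points of \<open>K\<close>.\<close>

lemma fragment_splice:
  fixes \<gamma> \<gamma>0 :: "real \<Rightarrow> 'a::metric_space"
  assumes frag: "curve_fragment K \<gamma>" and ab: "(a, b) \<in> gap_intervals K"
    and frag0: "curve_fragment K0 \<gamma>0" and ends0: "Inf K0 = a" "Sup K0 = b"
    and agree: "\<gamma>0 a = \<gamma> a" "\<gamma>0 b = \<gamma> b"
    and len: "fragment_len K \<gamma> \<le> ennreal l" "0 \<le> l"
    and len0: "fragment_len K0 \<gamma>0 \<le> ennreal l0" "0 \<le> l0"
    and av: "fragment_avoids E K \<gamma>" and av0: "fragment_avoids E K0 \<gamma>0"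
  defines "K1 \<equiv> K \<union> K0"
    and "\<gamma>1 \<equiv> (\<lambda>t. if t \<in> K then \<gamma> t else \<gamma>0 t)"
  shows "curve_fragment K1 \<gamma>1"
    and "Inf K1 = Inf K" and "Sup K1 = Sup K"
    and "gap_intervals K - {(a, b)} \<subseteq> gap_intervals K1"
    and "fragment_len K1 \<gamma>1 \<le> ennreal (l + l0)"
    and "fragment_gap K1 \<gamma>1 + ennreal (dist (\<gamma> a) (\<gamma> b)) \<le> fragment_gap K \<gamma> + fragment_gap K0 \<gamma>0"
    and "fragment_avoids E K1 \<gamma>1"
proof -
  have K: "compact K" "K \<noteq> {}" and K0: "compact K0" "K0 \<noteq> {}"
    using frag frag0 by (auto simp: curve_fragment_def)
  note I = compact_Inf_Sup[OF K] and I0 = compact_Inf_Sup[OF K0, unfolded ends0]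
  have K1: "compact K1" "K1 \<noteq> {}"
    using K K0 by (auto simp: K1_def)
  have g: "a < b" "a \<in> K" "b \<in> K" "\<And>t. t \<in> K \<Longrightarrow> t \<le> a \<or> b \<le> t"
    using ab unfolding gap_intervals_iff[OF K] by force+
  have in0: "a \<in> K0" "b \<in> K0" "\<And>t. t \<in> K0 \<Longrightarrow> a \<le> t \<and> t \<le> b"
    using I0 by blast+
  have both: "t = a \<or> t = b" if "t \<in> K" "t \<in> K0" for t
    using g(4)[OF that(1)] in0(3)[OF that(2)] by linarith
  have val: "\<gamma>1 t = \<gamma> t" if "t \<in> K" for t
    using that by (simp add: \<gamma>1_def)
  have val0: "\<gamma>1 t = \<gamma>0 t" if "t \<in> K0" for t
    using both[of t] that agree by (auto simp: \<gamma>1_def)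
  have IK: "Inf K \<le> a" "b \<le> Sup K"
    using I g by auto
  show inf: "Inf K1 = Inf K"
    by (rule cInf_eq_minimum) (use I IK in0 in \<open>force simp: K1_def\<close>)+
  show sup: "Sup K1 = Sup K"
    by (rule cSup_eq_maximum) (use I IK in0 in \<open>force simp: K1_def\<close>)+

  show "curve_fragment K1 \<gamma>1"
  proof -
    obtain L L0 where LL: "L-lipschitz_on K \<gamma>" "L0-lipschitz_on K0 \<gamma>0"
      using frag frag0 by (auto simp: curve_fragment_def)
    define N where "N = max L L0"
    have N0: "0 \<le> N"
      using LL(1) lipschitz_on_nonneg by (fastforce simp: N_def)
    have NK: "dist (\<gamma>1 s) (\<gamma>1 t) \<le> N * \<bar>s - t\<bar>" if "s \<in> K" "t \<in> K" for s t
      using lipschitz_onD[OF lipschitz_on_mono[OF LL(1) order_refl], of N s t] that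
      by (simp add: N_def val dist_real_def)
    have NK0: "dist (\<gamma>1 s) (\<gamma>1 t) \<le> N * \<bar>s - t\<bar>" if "s \<in> K0" "t \<in> K0" for s t
      using lipschitz_onD[OF lipschitz_on_mono[OF LL(2) order_refl], of N s t] that
      by (simp add: N_def val0 dist_real_def)
    \<comment> \<open>Between a point of \<open>K\<close> and one of \<open>K0\<close> lies one of the shared points \<open>a\<close> and \<open>b\<close>.\<close>
    have mixed: "dist (\<gamma>1 s) (\<gamma>1 t) \<le> N * \<bar>s - t\<bar>" if st: "s \<in> K" "t \<in> K0" for s t
    proof -
      obtain u where u: "u \<in> K" "u \<in> K0" "\<bar>s - u\<bar> + \<bar>u - t\<bar> = \<bar>s - t\<bar>"
        using g(4)[OF st(1)] in0(3)[OF st(2)] g(2,3) in0(1,2) by (smt (verit))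
      have "dist (\<gamma>1 s) (\<gamma>1 t) \<le> dist (\<gamma>1 s) (\<gamma>1 u) + dist (\<gamma>1 u) (\<gamma>1 t)"
        by (rule dist_triangle)
      also have "\<dots> \<le> N * \<bar>s - u\<bar> + N * \<bar>u - t\<bar>"
        using NK[of s u] NK0[of u t] u st by simp
      also have "\<dots> = N * \<bar>s - t\<bar>"
        by (metis distrib_left u(3))
      finally show ?thesis .
    qed
    have "N-lipschitz_on K1 \<gamma>1"
    proof (rule lipschitz_onI)
      fix s t assume "s \<in> K1" "t \<in> K1"
      then show "dist (\<gamma>1 s) (\<gamma>1 t) \<le> N * dist s t"
        using NK[of s t] NK0[of s t] mixed[of s t] mixed[of t s]
        by (auto simp: K1_def dist_real_def dist_commute abs_minus_commute)
    qed (rule N0)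
    then show ?thesis
      using K1 by (auto simp: curve_fragment_def)
  qed

  show "gap_intervals K - {(a, b)} \<subseteq> gap_intervals K1"
  proof (rule subrelI)
    fix s t assume "(s, t) \<in> gap_intervals K - {(a, b)}"
    then have st: "s < t" "s \<in> K" "t \<in> K" "{s<..<t} \<inter> K = {}" "(s, t) \<noteq> (a, b)"
      unfolding Diff_iff gap_intervals_iff[OF K] by auto
    have ab': "\<not> (s < a \<and> a < t)" "\<not> (s < b \<and> b < t)"
      using st(4) g(2,3) by auto
    have "{s<..<t} \<inter> K0 = {}"
    proof (rule ccontr)
      assume "{s<..<t} \<inter> K0 \<noteq> {}"
      then obtain u where "u \<in> {s<..<t}" "u \<in> K0"
        by blast
      then have u: "s < u" "u < t" "a \<le> u" "u \<le> b"
        using in0(3) by auto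
      then have "s = a \<and> t = b"
        using ab' g(4)[OF st(2)] g(4)[OF st(3)] by linarith
      then show False
        using st(5) by simp
    qed
    then show "(s, t) \<in> gap_intervals K1"
      unfolding gap_intervals_iff[OF K1] using st by (auto simp: K1_def)
  qed

  show "fragment_len K1 \<gamma>1 \<le> ennreal (l + l0)"
  proof -
    obtain v where v: "\<And>t. t \<in> K \<Longrightarrow> 0 \<le> v t \<and> v t \<le> l"
      "\<And>s t. s \<in> K \<Longrightarrow> t \<in> K \<Longrightarrow> s \<le> t \<Longrightarrow> dist (\<gamma> s) (\<gamma> t) \<le> v t - v s"
      using len(1) unfolding fragment_len_le_iff[OF len(2)] by blast
    obtain v0 where v0: "\<And>t. t \<in> K0 \<Longrightarrow> 0 \<le> v0 t \<and> v0 t \<le> l0"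
      "\<And>s t. s \<in> K0 \<Longrightarrow> t \<in> K0 \<Longrightarrow> s \<le> t \<Longrightarrow> dist (\<gamma>0 s) (\<gamma>0 t) \<le> v0 t - v0 s"
      using len0(1) unfolding fragment_len_le_iff[OF len0(2)] by blast
    define w where "w t = (if t \<in> K then if t \<le> a then v t else v t + l0 else v a + v0 t)" for t
    have v_mono: "v s \<le> v t" if "s \<in> K" "t \<in> K" "s \<le> t" for s t
      using v(2)[OF that] zero_le_dist[of "\<gamma> s" "\<gamma> t"] by linarith
    have "0 \<le> w t \<and> w t \<le> l + l0" if "t \<in> K1" for t
    proof (cases "t \<in> K")
      case True
      then show ?thesis
        using v(1)[of t] len0(2) by (auto simp: w_def)
    next
      case False
      then have "t \<in> K0"
        using that by (simp add: K1_def)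
      then show ?thesis
        using v(1)[OF g(2)] v0(1)[of t] False by (auto simp: w_def)
    qed
    moreover have "dist (\<gamma>1 s) (\<gamma>1 t) \<le> w t - w s" if st: "s \<in> K1" "t \<in> K1" "s \<le> t" for s t
    proof -
      consider "s \<in> K" "t \<in> K" | "s \<in> K" "t \<in> K0" "t \<notin> K" | "s \<in> K0" "s \<notin> K" "t \<in> K"
        | "s \<in> K0" "s \<notin> K" "t \<in> K0" "t \<notin> K"
        using st by (auto simp: K1_def)
      then show ?thesis
      proof cases
        case 1
        then show ?thesis
          using v(2)[OF 1 st(3)] len0(2) st(3) by (auto simp: w_def val)
      next
        case 2
        then have "s \<le> a"
          using g(4)[OF 2(1)] in0(3)[OF 2(2)] g(3) st(3) by (metis order_antisym order_trans)
        then have "dist (\<gamma>1 s) (\<gamma>1 t) \<le> (v a - v s) + (v0 t - v0 a)"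
          using dist_triangle[of "\<gamma>1 s" "\<gamma>1 t" "\<gamma>1 a"] v(2)[of s a] v0(2)[of a t] 2 g in0
          by (simp add: val val0) (metis add_mono agree(1) order_trans)
        then show ?thesis
          using v0(1)[OF in0(1)] 2 \<open>s \<le> a\<close> by (auto simp: w_def)
      next
        case 3
        then have "b \<le> t"
          using g(4)[OF 3(3)] in0(3)[OF 3(1)] g(2) st(3) by (metis order_antisym order_trans)
        then have "dist (\<gamma>1 s) (\<gamma>1 t) \<le> (v0 b - v0 s) + (v t - v b)"
          using dist_triangle[of "\<gamma>1 s" "\<gamma>1 t" "\<gamma>1 b"] v(2)[of b t] v0(2)[of s b] 3 g in0
          by (simp add: val val0) (metis add_mono agree(2) order_trans)
        then show ?thesis
          using v0(1)[OF in0(2)] v_mono[of a b] g 3 \<open>b \<le> t\<close> by (auto simp: w_def)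
      next
        case 4
        then show ?thesis
          using v0(2)[of s t] st(3) by (auto simp: w_def val0)
      qed
    qed
    moreover have "0 \<le> l + l0"
      using len(2) len0(2) by simp
    ultimately show ?thesis
      by (subst fragment_len_le_iff) blast+
  qed

  show "fragment_gap K1 \<gamma>1 + ennreal (dist (\<gamma> a) (\<gamma> b)) \<le> fragment_gap K \<gamma> + fragment_gap K0 \<gamma>0"
  proof -
    have sub: "gap_intervals K1 \<subseteq> (gap_intervals K - {(a, b)}) \<union> gap_intervals K0"
    proof (rule subrelI)
      fix s t assume "(s, t) \<in> gap_intervals K1"
      then have st: "s < t" "s \<in> K1" "t \<in> K1" "{s<..<t} \<inter> K = {}" "{s<..<t} \<inter> K0 = {}"
        unfolding gap_intervals_iff[OF K1] by (auto simp: K1_def)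
      have ab': "\<not> (s < a \<and> a < t)" "\<not> (s < b \<and> b < t)"
        using st(4) g(2,3) by auto
      show "(s, t) \<in> (gap_intervals K - {(a, b)}) \<union> gap_intervals K0"
      proof (cases "a \<le> s \<and> t \<le> b")
        case True
        then have "s \<in> K0" "t \<in> K0"
          using st(1-3) g(4)[of s] g(4)[of t] in0(1,2) by (auto simp: K1_def)
        then show ?thesis
          unfolding Un_iff gap_intervals_iff[OF K0] using st by auto
      next
        case False
        then have "s \<in> K \<and> t \<in> K \<and> (s, t) \<noteq> (a, b)"
          using st(1-3) ab' in0(3)[of s] in0(3)[of t] g(2,3) by (auto simp: K1_def)
        then show ?thesis
          unfolding Un_iff Diff_iff gap_intervals_iff[OF K] using st by auto
      qed
    qed
    define f where "f \<eta> = (\<lambda>(s, t). ennreal (dist (\<eta> s) (\<eta> t)))" for \<eta> :: "real \<Rightarrow> 'a"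
    have "fragment_gap K1 \<gamma>1 \<le> infsum (f \<gamma>1) ((gap_intervals K - {(a, b)}) \<union> gap_intervals K0)"
      unfolding fragment_gap_def f_def by (rule infsum_ennreal_subset_mono[OF sub])
    also have "\<dots> \<le> infsum (f \<gamma>1) (gap_intervals K - {(a, b)}) + infsum (f \<gamma>1) (gap_intervals K0)"
      by (rule infsum_ennreal_Un_le)
    also have "infsum (f \<gamma>1) (gap_intervals K - {(a, b)}) = infsum (f \<gamma>) (gap_intervals K - {(a, b)})"
      by (rule infsum_cong) (auto simp: f_def val gap_intervals_iff[OF K])
    also have "infsum (f \<gamma>1) (gap_intervals K0) = infsum (f \<gamma>0) (gap_intervals K0)"
      by (rule infsum_cong) (auto simp: f_def val0 gap_intervals_iff[OF K0])
    finally have *: "fragment_gap K1 \<gamma>1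
        \<le> infsum (f \<gamma>) (gap_intervals K - {(a, b)}) + fragment_gap K0 \<gamma>0"
      by (simp add: fragment_gap_def f_def)
    have "fragment_gap K \<gamma> = infsum (f \<gamma>) (insert (a, b) (gap_intervals K - {(a, b)}))"
      using ab by (simp add: fragment_gap_def f_def insert_absorb)
    also have "\<dots> = ennreal (dist (\<gamma> a) (\<gamma> b)) + infsum (f \<gamma>) (gap_intervals K - {(a, b)})"
      by (subst infsum_insert) (auto intro: nonneg_summable_on_complete simp: f_def)
    finally show ?thesis
      using add_right_mono[OF *, of "ennreal (dist (\<gamma> a) (\<gamma> b))"] by (simp add: ac_simps)
  qed

  show "fragment_avoids E K1 \<gamma>1"
  proof -
    have "t \<in> {Inf K, Sup K}" if t: "t \<in> K1" "\<gamma>1 t \<in> E" for t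
    proof -
      have "t \<in> K"
        using t av0 agree g(2,3) val0[of t]
        unfolding fragment_avoids_def ends0 K1_def by auto
      then show ?thesis
        using t av val[of t] unfolding fragment_avoids_def by auto
    qed
    then show ?thesis
      unfolding fragment_avoids_def inf sup by blast
  qed
qed

text \<open>Only finitely many gaps are filled: the fragments put into infinitely many gaps need not
  have a common Lipschitz constant.\<close>

lemma fragment_fill_gaps:
  fixes \<gamma> :: "real \<Rightarrow> 'a::metric_space"
  assumes "finite F" "F \<subseteq> gap_intervals K"
    and frag: "curve_fragment K \<gamma>" and len: "fragment_len K \<gamma> \<le> ennreal l" "0 \<le> l"
    and av: "fragment_avoids E K \<gamma>" and "0 \<le> A" "0 \<le> B"
    and fill: "\<And>a b. (a, b) \<in> F \<Longrightarrow>
      joined_on a b E (\<gamma> a) (\<gamma> b) (A * dist (\<gamma> a) (\<gamma> b)) (B * dist (\<gamma> a) (\<gamma> b))"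
  defines "T \<equiv> \<Sum>(a, b)\<in>F. dist (\<gamma> a) (\<gamma> b)"
  shows "\<exists>K' \<gamma>'. curve_fragment K' \<gamma>' \<and> K \<subseteq> K' \<and> (\<forall>t\<in>K. \<gamma>' t = \<gamma> t) \<and>
    Inf K' = Inf K \<and> Sup K' = Sup K \<and> gap_intervals K - F \<subseteq> gap_intervals K' \<and>
    fragment_len K' \<gamma>' \<le> ennreal (l + A * T) \<and>
    fragment_gap K' \<gamma>' + ennreal T \<le> fragment_gap K \<gamma> + ennreal (B * T) \<and>
    fragment_avoids E K' \<gamma>'"
  using assms(1,2) fill unfolding T_def
proof (induction F rule: finite_induct)
  case empty
  show ?case
    by (intro exI[of _ K] exI[of _ \<gamma>]) (use frag len av in auto)
next
  case (insert p F)
  obtain a b where p: "p = (a, b)"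
    by fastforce
  define T where "T = (\<Sum>(a, b)\<in>F. dist (\<gamma> a) (\<gamma> b))"
  define d where "d = dist (\<gamma> a) (\<gamma> b)"
  have T0: "0 \<le> T" "0 \<le> d"
    unfolding T_def d_def by (auto intro!: sum_nonneg)
  have T': "(\<Sum>(a, b)\<in>insert p F. dist (\<gamma> a) (\<gamma> b)) = d + T"
    using insert.hyps by (simp add: T_def d_def p)
  obtain K1 \<gamma>1 where 1: "curve_fragment K1 \<gamma>1" "K \<subseteq> K1" "\<forall>t\<in>K. \<gamma>1 t = \<gamma> t"
    "Inf K1 = Inf K" "Sup K1 = Sup K" "gap_intervals K - F \<subseteq> gap_intervals K1"
    "fragment_len K1 \<gamma>1 \<le> ennreal (l + A * T)"
    "fragment_gap K1 \<gamma>1 + ennreal T \<le> fragment_gap K \<gamma> + ennreal (B * T)"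
    "fragment_avoids E K1 \<gamma>1"
    using insert.IH insert.prems unfolding T_def by blast
  have abK: "(a, b) \<in> gap_intervals K" "(a, b) \<in> gap_intervals K1"
    using insert.prems(1) insert.hyps(2) 1(6) p by blast+
  have "compact K" "K \<noteq> {}"
    using frag by (auto simp: curve_fragment_def)
  then have "a \<in> K" "b \<in> K"
    using abK(1) gap_intervals_iff by blast+
  then have val: "\<gamma>1 a = \<gamma> a" "\<gamma>1 b = \<gamma> b"
    using 1(3) by auto
  obtain K0 \<gamma>0 where 0: "curve_fragment K0 \<gamma>0" "Inf K0 = a" "Sup K0 = b"
    "\<gamma>0 a = \<gamma>1 a" "\<gamma>0 b = \<gamma>1 b" "fragment_len K0 \<gamma>0 \<le> ennreal (A * d)"
    "fragment_gap K0 \<gamma>0 \<le> ennreal (B * d)" "fragment_avoids E K0 \<gamma>0"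
    using insert.prems(2)[of a b] unfolding joined_on_def fragment_connects_def p d_def val by auto
  have l: "0 \<le> l + A * T" "0 \<le> A * d"
    using len(2) \<open>0 \<le> A\<close> T0 by auto
  note S = fragment_splice[OF 1(1) abK(2) 0(1-5) 1(7) l(1) 0(6) l(2) 1(9) 0(8)]
  define K2 where "K2 = K1 \<union> K0"
  define \<gamma>2 where "\<gamma>2 = (\<lambda>t. if t \<in> K1 then \<gamma>1 t else \<gamma>0 t)"
  note S = S[folded K2_def \<gamma>2_def]
  have "fragment_gap K2 \<gamma>2 + ennreal (d + T) = (fragment_gap K2 \<gamma>2 + ennreal d) + ennreal T"
    using T0 by (simp add: ennreal_plus ac_simps)
  also have "\<dots> \<le> (fragment_gap K1 \<gamma>1 + ennreal (B * d)) + ennreal T"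
    using S(6) 0(7) unfolding val d_def[symmetric]
    by (meson add_left_mono add_right_mono order_trans)
  also have "\<dots> \<le> (fragment_gap K \<gamma> + ennreal (B * T)) + ennreal (B * d)"
    using add_right_mono[OF 1(8), of "ennreal (B * d)"] by (simp add: ac_simps)
  also have "\<dots> = fragment_gap K \<gamma> + ennreal (B * (d + T))"
    using T0 \<open>0 \<le> B\<close> by (simp add: ennreal_plus distrib_left ac_simps)
  finally have gap: "fragment_gap K2 \<gamma>2 + ennreal (d + T) \<le> fragment_gap K \<gamma> + ennreal (B * (d + T))" .
  have len2: "fragment_len K2 \<gamma>2 \<le> ennreal (l + A * (d + T))"
    using S(5) by (simp add: algebra_simps)
  show ?case
    unfolding T'
  proof (intro exI[of _ K2] exI[of _ \<gamma>2] conjI)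
    show "gap_intervals K - insert p F \<subseteq> gap_intervals K2"
      using S(4) 1(6) p by blast
    show "K \<subseteq> K2" "\<forall>t\<in>K. \<gamma>2 t = \<gamma> t"
      using 1(2,3) by (auto simp: K2_def \<gamma>2_def)
  qed (use S gap len2 1 in auto)
qed

text \<open>If the gaps have total size below \<open>g\<close> and each can be replaced by gaps of \<open>B\<close> times its
  size, then filling all but a negligible part of them already brings the total down to \<open>B * g\<close>,
  because the inequality for \<open>g\<close> is strict.\<close>

lemma fragment_refine:
  fixes \<gamma> :: "real \<Rightarrow> 'a::metric_space"
  assumes frag: "curve_fragment K \<gamma>" and len: "fragment_len K \<gamma> \<le> ennreal l" "0 \<le> l"
    and gap: "fragment_gap K \<gamma> < ennreal g" and av: "fragment_avoids E K \<gamma>"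
    and A: "0 \<le> A" and B: "0 < B" "B \<le> 1"
    and fill: "\<And>a b. (a, b) \<in> gap_intervals K \<Longrightarrow>
      joined_on a b E (\<gamma> a) (\<gamma> b) (A * dist (\<gamma> a) (\<gamma> b)) (B * dist (\<gamma> a) (\<gamma> b))"
  shows "joined_on (Inf K) (Sup K) E (\<gamma> (Inf K)) (\<gamma> (Sup K)) (l + A * g) (B * g)"
proof -
  obtain h where h: "fragment_gap K \<gamma> = ennreal h" "0 \<le> h"
    using gap by (cases "fragment_gap K \<gamma>") auto
  have hg: "h < g"
    using gap h by (simp add: ennreal_less_iff)
  define f where "f = (\<lambda>(s, t). dist (\<gamma> s) (\<gamma> t))"
  have f0: "0 \<le> f p" for p
    by (auto simp: f_def split: prod.splits)
  have sup: "ennreal h = (SUP F\<in>{F. finite F \<and> F \<subseteq> gap_intervals K}. sum (\<lambda>p. ennreal (f p)) F)"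
    unfolding h(1)[symmetric] fragment_gap_def
    by (subst nonneg_infsum_complete) (auto simp: f_def case_prod_unfold)
  have fin: "\<exists>F. finite F \<and> F \<subseteq> gap_intervals K \<and> h - B * (g - h) \<le> sum f F \<and> sum f F \<le> h"
  proof -
    have up: "sum f F \<le> h" if "finite F" "F \<subseteq> gap_intervals K" for F
    proof -
      have "ennreal (sum f F) \<le> ennreal h"
        unfolding sup sum_ennreal[OF f0, symmetric] by (rule SUP_upper) (use that in auto)
      then show ?thesis
        using h(2) by simp
    qed
    show ?thesis
    proof (cases "h - B * (g - h) \<le> 0")
      case True
      then show ?thesis
        using h(2) by (intro exI[of _ "{}"]) auto
    next
      case False
      then have "ennreal (h - B * (g - h)) < ennreal h"
        using hg B by (simp add: ennreal_less_iff)
      then obtain F where F: "finite F" "F \<subseteq> gap_intervals K"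
        "ennreal (h - B * (g - h)) < sum (\<lambda>p. ennreal (f p)) F"
        unfolding sup less_SUP_iff by auto
      then have "ennreal (h - B * (g - h)) < ennreal (sum f F)"
        by (simp add: sum_ennreal f0)
      then show ?thesis
        using F(1,2) up False by (intro exI[of _ F]) (auto simp: ennreal_less_iff)
    qed
  qed
  then obtain F where F: "finite F" "F \<subseteq> gap_intervals K"
    and Fl: "h - B * (g - h) \<le> sum f F" and Fu: "sum f F \<le> h"
    by blast
  define T where "T = sum f F"
  have T: "(\<Sum>(a, b)\<in>F. dist (\<gamma> a) (\<gamma> b)) = T" "0 \<le> T" "T \<le> h" "h - T \<le> B * (g - h)"
    using Fl Fu f0 by (auto simp: T_def f_def intro!: sum_nonneg)
  obtain K' \<gamma>' where *: "curve_fragment K' \<gamma>'" "K \<subseteq> K'" "\<forall>t\<in>K. \<gamma>' t = \<gamma> t"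
    "Inf K' = Inf K" "Sup K' = Sup K"
    "fragment_len K' \<gamma>' \<le> ennreal (l + A * T)"
    "fragment_gap K' \<gamma>' + ennreal T \<le> fragment_gap K \<gamma> + ennreal (B * T)"
    "fragment_avoids E K' \<gamma>'"
    using fragment_fill_gaps[OF F frag len av A order_less_imp_le[OF B(1)]] fill F(2)
    unfolding T(1) by blast
  have K: "compact K" "K \<noteq> {}"
    using frag by (auto simp: curve_fragment_def)
  have "fragment_gap K' \<gamma>' + ennreal T \<le> ennreal (h + B * T)"
    using *(7) h T B by (simp add: ennreal_plus)
  moreover have "h + B * T \<le> B * g + T"
  proof -
    have "B * T \<le> B * h"
      using T(3) B by (intro mult_left_mono) auto
    then show ?thesis
      using T(4) by (simp add: algebra_simps)
  qed
  ultimately have "fragment_gap K' \<gamma>' + ennreal T \<le> ennreal (B * g) + ennreal T"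
    using B h(2) hg T(2) by (metis ennreal_leI ennreal_plus mult_nonneg_nonneg order_less_imp_le order_trans)
  then have "fragment_gap K' \<gamma>' \<le> ennreal (B * g)"
    by (simp add: ennreal_add_left_cancel_le add.commute)
  moreover have "fragment_len K' \<gamma>' \<le> ennreal (l + A * g)"
  proof -
    have "A * T \<le> A * g"
      using T(3) hg A by (intro mult_left_mono) auto
    then show ?thesis
      using *(6) by (meson add_left_mono ennreal_leI order_trans)
  qed
  moreover have "\<gamma>' (Inf K) = \<gamma> (Inf K)" "\<gamma>' (Sup K) = \<gamma> (Sup K)"
    using *(3) compact_Inf_Sup[OF K] by auto
  ultimately show ?thesis
    unfolding joined_on_def fragment_connects_def using *(1,4,5,8) by metis
qed

section \<open>Doubling measures and the maximal function\<close>

lemma finite_Vitali_balls: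
  fixes c :: "'i \<Rightarrow> 'a::metric_space" and s :: "'i \<Rightarrow> real"
  assumes "finite I"
  shows "\<exists>J\<subseteq>I. disjoint_family_on (\<lambda>i. ball (c i) (s i)) J \<and>
           (\<forall>i\<in>I. \<exists>j\<in>J. ball (c i) (s i) \<subseteq> ball (c j) (3 * s j))"
  using assms
proof (induction I rule: finite_psubset_induct)
  case (psubset I)
  show ?case
  proof (cases "I = {}")
    case False
    \<comment> \<open>Greedy choice: a largest ball swallows, after enlargement, every ball that meets it.\<close>
    have "Max (s ` I) \<in> s ` I"
      using psubset.hyps False by (intro Max_in) auto
    then obtain m where m_max: "m \<in> I" "Max (s ` I) = s m"
      by auto
    have m: "m \<in> I" "\<And>i. i \<in> I \<Longrightarrow> s i \<le> s m"
      using psubset.hyps m_max(1) unfolding m_max(2)[symmetric] by auto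
    define I' where "I' = {i \<in> I - {m}. ball (c i) (s i) \<inter> ball (c m) (s m) = {}}"
    have "I' \<subset> I"
      using m(1) by (auto simp: I'_def)
    from psubset.IH[OF this] obtain J where J: "J \<subseteq> I'" "disjoint_family_on (\<lambda>i. ball (c i) (s i)) J"
      "\<forall>i\<in>I'. \<exists>j\<in>J. ball (c i) (s i) \<subseteq> ball (c j) (3 * s j)"
      by (elim exE conjE)
    have "m \<notin> J"
      using J(1) by (auto simp: I'_def)
    have "disjoint_family_on (\<lambda>i. ball (c i) (s i)) (insert m J)"
      unfolding disjoint_family_on_insert[OF \<open>m \<notin> J\<close>]
    proof
      show "ball (c m) (s m) \<inter> (\<Union>i\<in>J. ball (c i) (s i)) = {}"
        using J(1) unfolding I'_def by blast
    qed (rule J(2))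
    moreover have "\<exists>j\<in>insert m J. ball (c i) (s i) \<subseteq> ball (c j) (3 * s j)" if "i \<in> I" for i
    proof (cases "i \<in> I'")
      case False
      have "ball (c i) (s i) \<subseteq> ball (c m) (3 * s m)"
      proof (cases "ball (c i) (s i) \<inter> ball (c m) (s m) = {}")
        case True
        then have "i = m"
          using False that by (auto simp: I'_def)
        then have "ball (c i) (s i) = {}"
          using True by blast
        then show ?thesis
          by blast
      next
        case False
        then obtain w where w: "dist (c i) w < s i" "dist (c m) w < s m"
          by auto
        show ?thesis
        proof
          fix z assume "z \<in> ball (c i) (s i)"
          then have "dist (c i) z < s i"
            by simp
          then have "dist (c m) z < s m + s i + s i"
            using w dist_triangle[of "c m" z w] dist_triangle[of w z "c i"]
            by (simp add: dist_commute)
          then show "z \<in> ball (c m) (3 * s m)"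
            using m(2)[OF that] by simp
        qed
      qed
      then show ?thesis
        by blast
    qed (use J(3) in blast)
    moreover have "insert m J \<subseteq> I"
      using m(1) J(1) \<open>I' \<subset> I\<close> by blast
    ultimately show ?thesis
      by blast
  qed (auto simp: disjoint_family_on_def)
qed

text \<open>The weak type estimate for the maximal function of the indicator of \<open>E\<close>, stated for a union of
  balls in which \<open>E\<close> is dense.  This union is open, so measurability of the maximal function is not
  an issue, and inner regularity of \<open>\<mu>\<close> reduces the estimate to finitely many balls.  Enlarging a ball
  three times costs two doublings, hence \<open>D\<^sup>2\<close>.\<close>

lemma emeasure_dense_balls_le:
  fixes \<mu> :: "'a::polish_space measure"
  assumes mm: "metric_measure_space \<mu>" and dbl: "doubling \<mu> D R" and "0 \<le> D"
    and E: "E \<in> sets borel" and W: "W \<in> sets borel"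
    and dense: "\<And>z s. (z, s) \<in> \<B> \<Longrightarrow> 0 < s \<and> 2 * s < R \<and> ball z s \<subseteq> W \<and>
      ennreal p * emeasure \<mu> (ball z s) \<le> emeasure \<mu> (E \<inter> ball z s)"
  shows "ennreal p * emeasure \<mu> (\<Union>(z, s)\<in>\<B>. ball z s) \<le> ennreal (D\<^sup>2) * emeasure \<mu> (E \<inter> W)"
proof -
  have sets: "sets \<mu> = sets borel"
    and inner: "\<And>A. A \<in> sets borel \<Longrightarrow>
      emeasure \<mu> A = (SUP K\<in>{K. compact K \<and> K \<subseteq> A}. emeasure \<mu> K)"
    using mm unfolding metric_measure_space_def radon_measure_def by blast+
  define V where "V = (\<Union>(z, s)\<in>\<B>. ball z s)"
  have "V \<in> sets borel"
    unfolding V_def by (intro borel_open open_UN) auto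
  have cover: "ennreal p * emeasure \<mu> K \<le> ennreal (D\<^sup>2) * emeasure \<mu> (E \<inter> W)"
    if K: "compact K" "K \<subseteq> V" for K
  proof -
    define b where "b = (\<lambda>(z, s). ball z s :: 'a set)"
    have "\<exists>F\<subseteq>\<B>. finite F \<and> K \<subseteq> (\<Union>i\<in>F. b i)"
      by (rule compactE_image[OF K(1), of \<B> b]) (use K(2) in \<open>auto simp: V_def b_def\<close>)
    then obtain F where F: "F \<subseteq> \<B>" "finite F" "K \<subseteq> (\<Union>i\<in>F. b i)"
      by blast
    obtain J where J: "J \<subseteq> F" "disjoint_family_on (\<lambda>i. ball (fst i) (snd i)) J"
      "\<forall>i\<in>F. \<exists>j\<in>J. ball (fst i) (snd i) \<subseteq> ball (fst j) (3 * snd j)"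
      using finite_Vitali_balls[OF F(2), of fst snd] by blast
    have finJ: "finite J"
      using J(1) F(2) finite_subset by blast
    have "K \<subseteq> (\<Union>j\<in>J. ball (fst j) (3 * snd j))"
    proof
      fix w assume "w \<in> K"
      then obtain i where "i \<in> F" "w \<in> ball (fst i) (snd i)"
        using F(3) unfolding b_def case_prod_unfold by blast
      then show "w \<in> (\<Union>j\<in>J. ball (fst j) (3 * snd j))"
        using J(3) by blast
    qed
    then have "emeasure \<mu> K \<le> emeasure \<mu> (\<Union>j\<in>J. ball (fst j) (3 * snd j))"
      by (rule emeasure_mono) (auto simp: sets intro!: borel_open)
    also have "\<dots> \<le> (\<Sum>j\<in>J. emeasure \<mu> (ball (fst j) (3 * snd j)))"
      by (rule emeasure_subadditive_finite) (auto simp: sets finJ)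
    also have "\<dots> \<le> (\<Sum>j\<in>J. ennreal (D\<^sup>2) * emeasure \<mu> (ball (fst j) (snd j)))"
    proof (rule sum_mono)
      fix j assume "j \<in> J"
      then have "(fst j, snd j) \<in> \<B>"
        using J(1) F(1) by auto
      then have s: "0 < snd j" "2 * snd j < R"
        using dense by blast+
      have "emeasure \<mu> (ball (fst j) (3 * snd j)) \<le> emeasure \<mu> (ball (fst j) (2 * (2 * snd j)))"
        by (rule emeasure_mono) (use s in \<open>auto simp: sets\<close>)
      also have "\<dots> \<le> ennreal D * emeasure \<mu> (ball (fst j) (2 * snd j))"
        using dbl[unfolded doubling_def, rule_format, of "2 * snd j" "fst j"] s by simp
      also have "\<dots> \<le> ennreal D * (ennreal D * emeasure \<mu> (ball (fst j) (snd j)))"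
        using dbl s unfolding doubling_def by (intro mult_left_mono) auto
      also have "\<dots> = ennreal (D\<^sup>2) * emeasure \<mu> (ball (fst j) (snd j))"
        using \<open>0 \<le> D\<close> by (simp add: power2_eq_square ennreal_mult mult.assoc)
      finally show "emeasure \<mu> (ball (fst j) (3 * snd j))
          \<le> ennreal (D\<^sup>2) * emeasure \<mu> (ball (fst j) (snd j))" .
    qed
    finally have "ennreal p * emeasure \<mu> K
        \<le> ennreal p * (\<Sum>j\<in>J. ennreal (D\<^sup>2) * emeasure \<mu> (ball (fst j) (snd j)))"
      by (rule mult_left_mono) auto
    also have "\<dots> = ennreal (D\<^sup>2) * (\<Sum>j\<in>J. ennreal p * emeasure \<mu> (ball (fst j) (snd j)))"
      by (simp add: sum_distrib_left mult_ac)
    also have "\<dots> \<le> ennreal (D\<^sup>2) * (\<Sum>j\<in>J. emeasure \<mu> (E \<inter> ball (fst j) (snd j)))"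
    proof (intro mult_left_mono sum_mono)
      fix j assume "j \<in> J"
      then have "(fst j, snd j) \<in> \<B>"
        using J(1) F(1) by auto
      then show "ennreal p * emeasure \<mu> (ball (fst j) (snd j))
          \<le> emeasure \<mu> (E \<inter> ball (fst j) (snd j))"
        using dense by blast
    qed auto
    also have "(\<Sum>j\<in>J. emeasure \<mu> (E \<inter> ball (fst j) (snd j)))
        = emeasure \<mu> (\<Union>j\<in>J. E \<inter> ball (fst j) (snd j))"
    proof (rule sum_emeasure)
      show "disjoint_family_on (\<lambda>j. E \<inter> ball (fst j) (snd j)) J"
        using J(2) unfolding disjoint_family_on_def by blast
    qed (use finJ E in \<open>auto simp: sets\<close>)
    also have "\<dots> \<le> emeasure \<mu> (E \<inter> W)"
    proof (rule emeasure_mono)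
      show "(\<Union>j\<in>J. E \<inter> ball (fst j) (snd j)) \<subseteq> E \<inter> W"
      proof (intro UN_least Int_mono order_refl)
        fix j assume "j \<in> J"
        then have "(fst j, snd j) \<in> \<B>"
          using J(1) F(1) by auto
        then show "ball (fst j) (snd j) \<subseteq> W"
          using dense by blast
      qed
    qed (use E W in \<open>auto simp: sets\<close>)
    finally show ?thesis
      by (simp add: mult_left_mono)
  qed
  have "ennreal p * emeasure \<mu> V = (SUP K\<in>{K. compact K \<and> K \<subseteq> V}. ennreal p * emeasure \<mu> K)"
    unfolding inner[OF \<open>V \<in> sets borel\<close>] by (rule SUP_mult_left_ennreal)
  also have "\<dots> \<le> ennreal (D\<^sup>2) * emeasure \<mu> (E \<inter> W)"
    by (rule SUP_least) (use cover in auto)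
  finally show ?thesis
    by (simp add: V_def)
qed

text \<open>The number of doublings from \<open>r\<close> to \<open>r'\<close> is \<open>log 2 (r' / r)\<close> rounded up, which the summand
  \<open>1\<close> accounts for.\<close>

lemma doubling_iterate:
  fixes \<mu> :: "'a::polish_space measure"
  assumes sets: "sets \<mu> = sets borel" and dbl: "doubling \<mu> D R" and D: "1 \<le> D"
    and r: "0 < r" "r \<le> r'" "r' \<le> R"
  shows "emeasure \<mu> (ball x r') \<le> ennreal (D powr (log 2 (r' / r) + 1)) * emeasure \<mu> (ball x r)"
proof -
  have pow: "emeasure \<mu> (ball x (2 ^ n * r)) \<le> ennreal (D ^ n) * emeasure \<mu> (ball x r)"
    if "2 ^ n * r < 2 * R" for n
    using that
  proof (induction n)
    case (Suc n)
    then have n: "2 ^ n * r < R"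
      by simp
    have "0 < 2 ^ n * r"
      using r(1) by simp
    then have "emeasure \<mu> (ball x (2 ^ Suc n * r)) \<le> ennreal D * emeasure \<mu> (ball x (2 ^ n * r))"
      using dbl n unfolding doubling_def by (auto simp: mult.assoc)
    also have "\<dots> \<le> ennreal D * (ennreal (D ^ n) * emeasure \<mu> (ball x r))"
      using Suc.IH n \<open>0 < 2 ^ n * r\<close> by (intro mult_left_mono) auto
    also have "\<dots> = ennreal (D ^ Suc n) * emeasure \<mu> (ball x r)"
      using D by (simp add: ennreal_mult mult.assoc)
    finally show ?case .
  qed simp
  define u where "u = log 2 (r' / r)"
  have u: "0 \<le> u" "2 powr u = r' / r"
    using r by (auto simp: u_def)
  define n where "n = nat \<lceil>u\<rceil>"
  have n: "u \<le> n" "n < u + 1"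
    using u(1) unfolding n_def by linarith+
  have "2 powr u \<le> 2 powr n" "2 powr n < 2 powr (u + 1)"
    using n by simp_all
  then have "r' \<le> 2 ^ n * r" "2 ^ n * r < 2 * r'"
    using u(2) r(1) by (simp_all add: powr_realpow powr_add field_simps)
  then have "emeasure \<mu> (ball x r') \<le> emeasure \<mu> (ball x (2 ^ n * r))" "2 ^ n * r < 2 * R"
    using r by (auto intro!: emeasure_mono simp: sets)
  then have "emeasure \<mu> (ball x r') \<le> ennreal (D ^ n) * emeasure \<mu> (ball x r)"
    using pow order_trans by blast
  also have "\<dots> \<le> ennreal (D powr (u + 1)) * emeasure \<mu> (ball x r)"
  proof (intro mult_right_mono ennreal_leI)
    have "D ^ n = D powr n"
      using D by (simp add: powr_realpow)
    also have "\<dots> \<le> D powr (u + 1)"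
      using D n by (intro powr_mono) auto
    finally show "D ^ n \<le> D powr (u + 1)" .
  qed auto
  finally show ?thesis
    by (simp add: u_def)
qed

text \<open>If \<open>E\<close> has density below \<open>p * \<epsilon> / (2 * M)\<close> in the large ball of radius \<open>C * r / (1 - \<delta>)\<close>, then a
  set \<open>U\<close> that is small enough for the assumed connectivity contains \<open>E\<close> and those points within
  distance \<open>C * r\<close> of \<open>x\<close> around which \<open>E\<close> has density at least \<open>p\<close> at a scale that gaps of size
  below \<open>\<delta> * r\<close> can require.  The constant \<open>M\<close> collects two doublings from the weak type estimate
  and \<open>1 - log 2 (1 - \<delta>)\<close> doublings for the passage from the large ball to the one of radius
  \<open>C * r\<close>; the remaining factors leave room for \<open>E\<close> itself.\<close>

lemma exceptional_set:
  fixes \<mu> :: "'a::polish_space measure" and \<delta> \<epsilon> r0 C D M p r :: real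
  assumes mm: "metric_measure_space \<mu>" and dbl: "doubling \<mu> D r0" and D: "1 \<le> D"
    and \<delta>: "0 < \<delta>" "\<delta> < 1" and \<epsilon>: "0 < \<epsilon>" and C: "1 \<le> C" and p: "0 < p" "p \<le> 1"
    and M: "M = 2 * D powr (- log 2 (1 - \<delta>) + 4)"
    and r: "0 < r" "8 * (C / (1 - \<delta>)) * r \<le> r0"
    and E: "E \<in> sets borel"
    and small: "emeasure \<mu> (E \<inter> ball x (C / (1 - \<delta>) * r))
      < ennreal (p * (\<epsilon> / (2 * M))) * emeasure \<mu> (ball x (C / (1 - \<delta>) * r))"
  shows "\<exists>U\<in>sets borel. E \<subseteq> U \<and>
    emeasure \<mu> (U \<inter> ball x (C * r)) < ennreal \<epsilon> * emeasure \<mu> (ball x (C * r)) \<and>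
    (\<forall>z s. dist x z \<le> C * r \<and> z \<notin> U \<and> 0 < s \<and> s < C / (1 - \<delta>) * (\<delta> * r) \<longrightarrow>
       emeasure \<mu> (E \<inter> ball z s) < ennreal p * emeasure \<mu> (ball z s))"
proof -
  have sets: "sets \<mu> = sets borel"
    and pos: "\<And>x r. r > 0 \<Longrightarrow> 0 < emeasure \<mu> (ball x r) \<and> emeasure \<mu> (ball x r) < \<infinity>"
    using mm unfolding metric_measure_space_def radon_measure_def by blast+
  define C1 where "C1 = C / (1 - \<delta>)"
  have "C1 * (1 - \<delta>) = C"
    using \<delta> by (simp add: C1_def)
  then have C1: "C1 - C1 * \<delta> = C"
    by (simp add: algebra_simps)
  have C1_ge: "C \<le> C1" "0 < C1"
    using \<delta> C by (auto simp: C1_def field_simps)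
  have C1r: "C * r + C1 * (\<delta> * r) = C1 * r" "C * r \<le> C1 * r" "0 < C * r" "C1 * (\<delta> * r) < C1 * r"
    using C1_ge r(1) C \<delta> by (auto simp: C1[symmetric] algebra_simps)
  have C1r0: "8 * (C1 * r) \<le> r0"
    using r(2) by (simp add: C1_def)
  define \<B> where "\<B> = {(z, s). dist x z \<le> C * r \<and> 0 < s \<and> s < C1 * (\<delta> * r) \<and>
    ennreal p * emeasure \<mu> (ball z s) \<le> emeasure \<mu> (E \<inter> ball z s)}"
  define V where "V = (\<Union>(z, s)\<in>\<B>. ball z s)"
  define W where "W = ball x (C1 * r)"
  have V: "V \<in> sets borel"
    unfolding V_def by (intro borel_open open_UN) auto
  \<comment> \<open>The choice of \<open>C1\<close> makes every ball in question stay inside the large ball.\<close>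
  have "ennreal p * emeasure \<mu> V \<le> ennreal (D\<^sup>2) * emeasure \<mu> (E \<inter> W)"
    unfolding V_def
  proof (rule emeasure_dense_balls_le[OF mm dbl _ E])
    fix z s assume "(z, s) \<in> \<B>"
    then have zs: "dist x z \<le> C * r" "0 < s" "s < C1 * (\<delta> * r)"
      "ennreal p * emeasure \<mu> (ball z s) \<le> emeasure \<mu> (E \<inter> ball z s)"
      by (auto simp: \<B>_def)
    have "ball z s \<subseteq> W"
    proof
      fix w assume "w \<in> ball z s"
      then have "dist x w < C * r + C1 * (\<delta> * r)"
        using zs dist_triangle[of x w z] by simp
      then show "w \<in> W"
        by (simp add: W_def C1r(1))
    qed
    moreover have "2 * s < r0"
      using zs C1r C1r0 by linarith
    ultimately show "0 < s \<and> 2 * s < r0 \<and> ball z s \<subseteq> W \<and>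
        ennreal p * emeasure \<mu> (ball z s) \<le> emeasure \<mu> (E \<inter> ball z s)"
      using zs by blast
  qed (use D in \<open>auto simp: W_def\<close>)
  moreover obtain m1 where m1: "emeasure \<mu> W = ennreal m1" "0 \<le> m1"
    using pos[of "C1 * r" x] C1r unfolding W_def by (cases "emeasure \<mu> (ball x (C1 * r))") auto
  obtain m0 where m0: "emeasure \<mu> (ball x (C * r)) = ennreal m0" "0 < m0"
    using pos[of "C * r" x] C1r by (cases "emeasure \<mu> (ball x (C * r))") auto
  define q where "q = \<epsilon> / (2 * M)"
  define N where "N = D powr (- log 2 (1 - \<delta>) + 1)"
  have N: "0 < N" "M = 2 * (D ^ 3 * N)"
  proof -
    have "M = 2 * D powr (3 + (- log 2 (1 - \<delta>) + 1))"
      unfolding M by (simp add: add.commute)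
    also have "\<dots> = 2 * (D powr 3 * N)"
      by (simp only: powr_add N_def)
    also have "D powr 3 = D ^ 3"
      using D by (simp add: powr_numeral)
    finally show "M = 2 * (D ^ 3 * N)" .
    show "0 < N"
      using D by (simp add: N_def)
  qed
  have q: "0 < q"
    using N D \<epsilon> by (simp add: q_def)
  have "emeasure \<mu> (E \<inter> W) < ennreal (p * q) * ennreal m1"
    using small unfolding q_def C1_def[symmetric] W_def[symmetric] m1 .
  then have EW: "emeasure \<mu> (E \<inter> W) < ennreal (p * q * m1)"
    using p q m1(2) by (simp add: ennreal_mult)
  then obtain e where e: "emeasure \<mu> (E \<inter> W) = ennreal e" "0 \<le> e" "e < p * q * m1"
    by (cases "emeasure \<mu> (E \<inter> W)") (auto simp: ennreal_less_iff)
  ultimately have pV: "ennreal p * emeasure \<mu> V \<le> ennreal (D\<^sup>2 * e)"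
    by (simp add: ennreal_mult)
  then have "emeasure \<mu> V \<noteq> top"
    using p by (auto simp: ennreal_mult_top top_unique)
  then obtain v where v: "emeasure \<mu> V = ennreal v" "0 \<le> v"
    by (cases "emeasure \<mu> V") auto
  have "p * v \<le> D\<^sup>2 * e"
    using pV v e(2) p by (simp add: ennreal_mult[symmetric])
  also have "\<dots> \<le> D\<^sup>2 * (p * q * m1)"
    using e(3) by (intro mult_left_mono) auto
  finally have "p * v \<le> p * (D\<^sup>2 * (q * m1))"
    by (simp add: mult_ac)
  then have v_le: "v \<le> D\<^sup>2 * (q * m1)"
    using p by simp
  have e_le: "e \<le> D\<^sup>2 * (q * m1)"
  proof -
    have "p \<le> D\<^sup>2"
      using p(2) one_le_power[OF D, of 2] by linarith
    then have "p * (q * m1) \<le> D\<^sup>2 * (q * m1)"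
      using q m1(2) by (intro mult_right_mono) auto
    then show ?thesis
      using e(3) by (simp add: mult.assoc)
  qed
  have "emeasure \<mu> W \<le> ennreal N * emeasure \<mu> (ball x (C * r))"
  proof -
    have "C1 * r / (C * r) = 1 / (1 - \<delta>)"
      using r(1) C \<delta> by (simp add: C1_def)
    moreover have "log 2 (1 / (1 - \<delta>)) = - log 2 (1 - \<delta>)"
      using \<delta> by (simp add: log_divide)
    moreover have "0 < C1 * r"
      using C1r by linarith
    ultimately show ?thesis
      using doubling_iterate[OF sets dbl D, of "C * r" "C1 * r" x] C1r C1r0
      unfolding N_def W_def by auto
  qed
  then have "m1 \<le> N * m0"
    using m0 m1 N(1) by (simp add: ennreal_mult[symmetric])
  then have "e + v \<le> 2 * (D\<^sup>2 * (q * (N * m0)))"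
    using v_le e_le q by (smt (verit) mult_left_mono zero_le_power2)
  also have "\<dots> < \<epsilon> * m0"
  proof -
    have "M * q = \<epsilon> / 2"
      using N D by (simp add: q_def)
    moreover have "2 * (D\<^sup>2 * (q * (N * m0))) * D = M * q * m0"
      by (simp add: N(2) power2_eq_square power3_eq_cube)
    ultimately have *: "2 * (D\<^sup>2 * (q * (N * m0))) * D = \<epsilon> / 2 * m0"
      by (simp only:)
    have "0 \<le> 2 * (D\<^sup>2 * (q * (N * m0)))"
      using q N(1) m0(2) by auto
    then have "2 * (D\<^sup>2 * (q * (N * m0))) \<le> 2 * (D\<^sup>2 * (q * (N * m0))) * D"
      using mult_left_mono[OF D] by fastforce
    moreover have "\<epsilon> / 2 * m0 < \<epsilon> * m0"
      using \<epsilon> m0(2) by simp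
    ultimately show ?thesis
      using * by linarith
  qed
  finally have ev: "e + v < \<epsilon> * m0" .
  define U where "U = E \<union> V"
  have "emeasure \<mu> (U \<inter> ball x (C * r)) \<le> emeasure \<mu> ((E \<inter> W) \<union> V)"
    by (rule emeasure_mono) (use E V C1r(2) in \<open>auto simp: U_def W_def sets\<close>)
  also have "\<dots> \<le> emeasure \<mu> (E \<inter> W) + emeasure \<mu> V"
    by (rule emeasure_subadditive) (use E V in \<open>auto simp: sets W_def\<close>)
  also have "\<dots> = ennreal (e + v)"
    using e v by simp
  also have "\<dots> < ennreal (\<epsilon> * m0)"
    by (rule ennreal_lessI) (use ev e(2) v(2) in linarith)+
  finally have 1: "emeasure \<mu> (U \<inter> ball x (C * r)) < ennreal \<epsilon> * emeasure \<mu> (ball x (C * r))"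
    using m0 \<epsilon> by (simp add: ennreal_mult)
  have 2: "emeasure \<mu> (E \<inter> ball z s) < ennreal p * emeasure \<mu> (ball z s)"
    if "dist x z \<le> C * r" "z \<notin> U" "0 < s" "s < C1 * (\<delta> * r)" for z s
  proof (rule ccontr)
    assume "\<not> ?thesis"
    then have "(z, s) \<in> \<B>"
      using that by (auto simp: \<B>_def not_less)
    then have "z \<in> V"
      using that(3) unfolding V_def by force
    then show False
      using that(2) by (simp add: U_def)
  qed
  show ?thesis
    using 1 2 E V unfolding C1_def[symmetric] by (intro bexI[of _ U]) (auto simp: U_def)
qed

section \<open>Iterating the connectivity\<close>

text \<open>The statement that is iterated.  Its bound on the gaps is not strict, so that a single jump
  qualifies for \<open>g = 1\<close>.\<close>

definition joined_if_sparse ::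
    "'a::polish_space measure \<Rightarrow> real \<Rightarrow> real \<Rightarrow> real \<Rightarrow> real \<Rightarrow> bool" where
  "joined_if_sparse \<mu> R C p g \<longleftrightarrow>
     (\<forall>x y. \<forall>E\<in>sets borel. 0 < dist x y \<and> dist x y \<le> R \<and>
        emeasure \<mu> (E \<inter> ball x (C * dist x y)) < ennreal p * emeasure \<mu> (ball x (C * dist x y)) \<longrightarrow>
        joined_on 0 1 E x y (C * dist x y) (g * dist x y))"

lemma joined_on_mono:
  assumes "joined_on a b E x y l g" "l \<le> l'" "g \<le> g'"
  shows "joined_on a b E x y l' g'"
  using assms(1) ennreal_leI[OF assms(2)] ennreal_leI[OF assms(3)] order_trans
  unfolding joined_on_def by metis

text \<open>The assumed connectivity, applied to the exceptional set of \<open>E\<close>, gives a fragment with total gap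
  below \<open>\<delta> * r\<close>.  The ends of its gaps lie outside the exceptional set, except possibly the two points
  \<open>x\<close> and \<open>y\<close>; a gap has another end than these, because it is shorter than \<open>r\<close>.  Around that end
  \<open>E\<close> has density below \<open>p\<close> at the scale of the gap, and the hypothesis on \<open>p\<close> and \<open>g\<close> fills it.  The
  bound on the length reproduces itself, because \<open>C * r + C1 * \<delta> * r = C1 * r\<close> for \<open>C1 = C / (1 - \<delta>)\<close>.\<close>

lemma joined_if_sparse_Suc:
  fixes \<mu> :: "'a::polish_space measure" and \<delta> \<epsilon> r0 C D M p g :: real
  assumes mm: "metric_measure_space \<mu>" and dbl: "doubling \<mu> D r0" and D: "1 \<le> D"
    and conn: "fragment_connected_space \<mu> C \<delta> \<epsilon> r0"
    and \<delta>: "0 < \<delta>" "\<delta> < 1" and \<epsilon>: "0 < \<epsilon>" and C: "1 \<le> C"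
    and p: "0 < p" "p \<le> 1" and g: "0 < g" "g \<le> 1"
    and M: "M = 2 * D powr (- log 2 (1 - \<delta>) + 4)"
    and IH: "joined_if_sparse \<mu> (r0 / (8 * (C / (1 - \<delta>)))) (C / (1 - \<delta>)) p g"
  shows "joined_if_sparse \<mu> (r0 / (8 * (C / (1 - \<delta>)))) (C / (1 - \<delta>)) (p * (\<epsilon> / (2 * M))) (g * \<delta>)"
  unfolding joined_if_sparse_def
proof (intro allI ballI impI, elim conjE)
  fix x y :: 'a and E :: "'a set"
  assume E: "E \<in> sets borel"
  define C1 where "C1 = C / (1 - \<delta>)"
  define r where "r = dist x y"
  assume "0 < dist x y" "dist x y \<le> r0 / (8 * (C / (1 - \<delta>)))"
    and "emeasure \<mu> (E \<inter> ball x (C / (1 - \<delta>) * dist x y))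
      < ennreal (p * (\<epsilon> / (2 * M))) * emeasure \<mu> (ball x (C / (1 - \<delta>) * dist x y))"
  then have r: "0 < r" "r \<le> r0 / (8 * C1)"
    and small: "emeasure \<mu> (E \<inter> ball x (C / (1 - \<delta>) * r))
      < ennreal (p * (\<epsilon> / (2 * M))) * emeasure \<mu> (ball x (C / (1 - \<delta>) * r))"
    by (simp_all add: r_def C1_def)
  have C1_mult: "C1 * (1 - \<delta>) = C"
    using \<delta> by (simp add: C1_def)
  have "C * (1 - \<delta>) \<le> C * 1"
    using \<delta> C by (intro mult_left_mono) auto
  then have C1: "C \<le> C1" "1 \<le> C1"
    using \<delta> C by (auto simp: C1_def field_simps)
  have r0: "8 * C1 * r \<le> r0"
    using r(2) C1(2) by (simp add: field_simps)
  moreover have "r \<le> C1 * r"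
    using C1(2) r(1) mult_right_mono by fastforce
  ultimately have rr0: "r \<le> r0"
    using r(1) by linarith
  obtain U where U: "U \<in> sets borel" "E \<subseteq> U"
    "emeasure \<mu> (U \<inter> ball x (C * r)) < ennreal \<epsilon> * emeasure \<mu> (ball x (C * r))"
    and sparse: "\<And>z s. dist x z \<le> C * r \<Longrightarrow> z \<notin> U \<Longrightarrow> 0 < s \<Longrightarrow> s < C1 * (\<delta> * r) \<Longrightarrow>
      emeasure \<mu> (E \<inter> ball z s) < ennreal p * emeasure \<mu> (ball z s)"
    using exceptional_set[OF mm dbl D \<delta> \<epsilon> C p M r(1) _ E small] r0 unfolding C1_def by blast
  have "fragment_connected_pair \<mu> C \<delta> \<epsilon> x y"
    using conn r(1) rr0 unfolding fragment_connected_space_def r_def by blast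
  then obtain K \<gamma> where frag: "curve_fragment K \<gamma>" and xy: "\<gamma> (Inf K) = x" "\<gamma> (Sup K) = y"
    and len: "fragment_len K \<gamma> \<le> ennreal (C * r)"
    and gap: "fragment_gap K \<gamma> < ennreal (\<delta> * r)" and av: "fragment_avoids U K \<gamma>"
    using U(1,3) unfolding fragment_connected_pair_def fragment_connects_def fragment_avoids_def
      r_def by blast
  have K: "compact K" "K \<noteq> {}"
    using frag by (auto simp: curve_fragment_def)
  note I = compact_Inf_Sup[OF K]
  have "Inf K \<noteq> Sup K"
    using xy r(1) r_def by auto
  then have IS: "Inf K < Sup K"
    using I by force
  have Cr: "0 \<le> C * r"
    using C r(1) by simp
  have avE: "fragment_avoids E K \<gamma>"
    using av U(2) unfolding fragment_avoids_def by blast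
  have "joined_on (Inf K) (Sup K) E (\<gamma> (Inf K)) (\<gamma> (Sup K)) (C * r + C1 * (\<delta> * r)) (g * (\<delta> * r))"
  proof (rule fragment_refine[OF frag len Cr gap avE _ g])
    fix a b assume ab: "(a, b) \<in> gap_intervals K"
    then have abK: "a < b" "a \<in> K" "b \<in> K"
      unfolding gap_intervals_iff[OF K] by auto
    define d where "d = dist (\<gamma> a) (\<gamma> b)"
    have "ennreal d < ennreal (\<delta> * r)"
      using dist_le_fragment_gap[OF ab, of \<gamma>] gap unfolding d_def by (rule order_le_less_trans)
    then have d_less: "d < \<delta> * r"
      by (simp add: d_def ennreal_less_iff)
    show "joined_on a b E (\<gamma> a) (\<gamma> b) (C1 * dist (\<gamma> a) (\<gamma> b)) (g * dist (\<gamma> a) (\<gamma> b))"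
    proof (cases "d = 0")
      case True
      then show ?thesis
        using joined_on_jump[OF abK(1), of E "\<gamma> a" "\<gamma> b"] by (simp add: d_def)
    next
      case False
      then have d0: "0 < d"
        by (simp add: d_def)
      have sparse_at: "emeasure \<mu> (E \<inter> ball (\<gamma> t) (C1 * d)) < ennreal p * emeasure \<mu> (ball (\<gamma> t) (C1 * d))"
        if t: "t \<in> K" "t \<noteq> Inf K" "t \<noteq> Sup K" for t
      proof (rule sparse)
        show "dist x (\<gamma> t) \<le> C * r"
          using dist_le_fragment_len[OF len Cr I(1) t(1)] xy by simp
        show "\<gamma> t \<notin> U"
          using av t unfolding fragment_avoids_def by blast
        show "0 < C1 * d" "C1 * d < C1 * (\<delta> * r)"
          using C1 d0 d_less by auto
      qed
      have "\<delta> * r \<le> r"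
        using \<delta> r(1) by simp
      then have dr: "d \<le> r0 / (8 * C1)" "d < r"
        using d_less r(2) by linarith+
      have C1d: "0 \<le> C1 * d"
        using C1 d0 by simp
      show ?thesis
      proof (cases "a = Inf K")
        case False
        then have "a \<noteq> Inf K" "a \<noteq> Sup K"
          using abK I(3)[of b] by auto
        then have "joined_on 0 1 E (\<gamma> a) (\<gamma> b) (C1 * d) (g * d)"
          using IH E d0 dr(1) sparse_at[OF abK(2)]
          unfolding joined_if_sparse_def d_def C1_def by blast
        then show ?thesis
          using joined_on_rescale(1)[OF _ C1d _ abK(1)] unfolding d_def by force
      next
        \<comment> \<open>Nothing is known about \<open>E\<close> near \<open>x\<close> at small scales, so the gap at \<open>x\<close> is filled
          backwards, from its other end.\<close>
        case True
        have "b \<noteq> Sup K"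
          using True dr(2) xy by (auto simp: d_def r_def)
        moreover have "b \<noteq> Inf K"
          using True abK by simp
        ultimately have "joined_on 0 1 E (\<gamma> b) (\<gamma> a) (C1 * d) (g * d)"
          using IH E d0 dr(1) sparse_at[OF abK(3)]
          unfolding joined_if_sparse_def d_def C1_def dist_commute[of "\<gamma> a" "\<gamma> b"] by blast
        then show ?thesis
          using joined_on_rescale(2)[OF _ C1d _ abK(1)] unfolding d_def by force
      qed
    qed
  qed (use C1 in auto)
  moreover have "C * r + C1 * (\<delta> * r) = C1 * r"
    by (simp add: C1_mult[symmetric] algebra_simps)
  ultimately have "joined_on (Inf K) (Sup K) E x y (C1 * r) (g * \<delta> * r)"
    using xy by (simp add: mult.assoc)
  moreover have "0 \<le> C1 * r"
    using C1 r(1) by simp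
  ultimately have "joined_on 0 1 E x y (C1 * r) (g * \<delta> * r)"
    using joined_on_rescale(1)[OF _ _ IS zero_less_one] by blast
  then show "joined_on 0 1 E x y (C / (1 - \<delta>) * dist x y) (g * \<delta> * dist x y)"
    by (simp add: C1_def r_def)
qed

lemma joined_if_sparse_power:
  fixes \<mu> :: "'a::polish_space measure" and \<delta> \<epsilon> r0 C D M :: real
  assumes mm: "metric_measure_space \<mu>" and dbl: "doubling \<mu> D r0" and D: "1 \<le> D"
    and conn: "fragment_connected_space \<mu> C \<delta> \<epsilon> r0"
    and \<delta>: "0 < \<delta>" "\<delta> < 1" and \<epsilon>: "0 < \<epsilon>" and C: "1 \<le> C"
    and M: "M = 2 * D powr (- log 2 (1 - \<delta>) + 4)"
    and q: "\<epsilon> / (2 * M) \<le> 1"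
  shows "joined_if_sparse \<mu> (r0 / (8 * (C / (1 - \<delta>)))) (C / (1 - \<delta>)) ((\<epsilon> / (2 * M)) ^ n) (\<delta> ^ n)"
proof (induction n)
  case 0
  have C1: "1 \<le> C / (1 - \<delta>)"
    using \<delta> C by (simp add: pos_le_divide_eq)
  have "joined_on 0 1 E x y (C / (1 - \<delta>) * dist x y) (1 * dist x y)" for E and x y :: 'a
  proof (rule joined_on_mono[OF joined_on_jump[OF zero_less_one]])
    show "dist x y \<le> C / (1 - \<delta>) * dist x y"
      using mult_right_mono[OF C1 zero_le_dist[of x y]] by simp
  qed simp
  then show ?case
    unfolding joined_if_sparse_def by simp
next
  case (Suc n)
  have "0 < M"
    using D by (simp add: M)
  then have p: "0 < (\<epsilon> / (2 * M)) ^ n" "(\<epsilon> / (2 * M)) ^ n \<le> 1"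
    using \<epsilon> q by (auto intro!: power_le_one)
  have g: "0 < \<delta> ^ n" "\<delta> ^ n \<le> 1"
    using \<delta> by (auto intro!: power_le_one)
  show ?case
    using joined_if_sparse_Suc[OF mm dbl D conn \<delta> \<epsilon> C p g M Suc.IH]
    by (simp only: power_Suc2)
qed

section \<open>A lower bound for the gap parameter\<close>

text \<open>A fragment that leaves the ball of radius \<open>s'\<close> without meeting the annulus has to jump across it:
  the last parameter with value in the inner closed ball and the next one with value outside the outer
  ball bound a gap.\<close>

lemma fragment_gap_ge_annulus:
  assumes frag: "curve_fragment K \<gamma>" and start: "\<gamma> (Inf K) = x"
    and "0 \<le> s" "s < s'" "s' \<le> dist x (\<gamma> (Sup K))"
    and av: "fragment_avoids (ball x s' - ball x s) K \<gamma>"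
  shows "ennreal (s' - s) \<le> fragment_gap K \<gamma>"
proof -
  have K: "compact K" "K \<noteq> {}"
    using frag by (auto simp: curve_fragment_def)
  note I = compact_Inf_Sup[OF K]
  have "continuous_on K \<gamma>"
    using frag lipschitz_on_continuous_on unfolding curve_fragment_def by blast
  then have cont: "continuous_on K (\<lambda>t. dist x (\<gamma> t))"
    by (intro continuous_intros)
  have closed_sub: "closed {t \<in> K. dist x (\<gamma> t) \<in> S}" if "closed S" for S
  proof -
    have "{t \<in> K. dist x (\<gamma> t) \<in> S} = K \<inter> (\<lambda>t. dist x (\<gamma> t)) -` S"
      by blast
    then show ?thesis
      using continuous_closed_preimage[OF cont compact_imp_closed[OF K(1)] that] by simp
  qed
  define K1 where "K1 = {t \<in> K. dist x (\<gamma> t) \<le> s}"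
  have "closed K1"
    using closed_sub[OF closed_atMost[of s]] by (simp add: K1_def)
  moreover have "Inf K \<in> K1"
    using I(1) start \<open>0 \<le> s\<close> by (simp add: K1_def)
  moreover have "K \<inter> K1 = K1"
    by (auto simp: K1_def)
  ultimately have K1: "compact K1" "K1 \<noteq> {}"
    using compact_Int_closed[OF K(1), of K1] by auto
  note I1 = compact_Inf_Sup[OF K1]
  define a where "a = Sup K1"
  have a: "a \<in> K" "dist x (\<gamma> a) \<le> s"
    using I1(2) by (auto simp: a_def K1_def)
  define K2 where "K2 = {t \<in> K. s' \<le> dist x (\<gamma> t)} \<inter> {a..}"
  have "closed K2"
    unfolding K2_def using closed_sub[OF closed_atLeast[of s']] by (intro closed_Int) auto
  moreover have "Sup K \<in> K2"
    using I(2) I(3)[OF a(1)] assms(5) by (simp add: K2_def)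
  moreover have "K \<inter> K2 = K2"
    by (auto simp: K2_def)
  ultimately have K2: "compact K2" "K2 \<noteq> {}"
    using compact_Int_closed[OF K(1), of K2] by auto
  note I2 = compact_Inf_Sup[OF K2]
  define b where "b = Inf K2"
  have b: "b \<in> K" "s' \<le> dist x (\<gamma> b)" "a \<le> b"
    using I2(1) by (auto simp: b_def K2_def)
  have "a \<noteq> b"
    using a(2) b(2) \<open>s < s'\<close> by auto
  then have "a < b"
    using b(3) by simp
  moreover have "{a<..<b} \<inter> K = {}"
  proof (rule ccontr)
    assume "{a<..<b} \<inter> K \<noteq> {}"
    then obtain t where t: "a < t" "t < b" "t \<in> K"
      by auto
    have "t \<notin> K1" "t \<notin> K2"
      using I1(3)[of t] I2(3)[of t] t by (auto simp: a_def b_def)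
    then have "\<gamma> t \<in> ball x s' - ball x s"
      using t by (auto simp: K1_def K2_def)
    then have "t = Inf K \<or> t = Sup K"
      using av t(3) unfolding fragment_avoids_def by blast
    then show False
      using I(3)[OF a(1)] I(3)[OF b(1)] t by linarith
  qed
  ultimately have "(a, b) \<in> gap_intervals K"
    unfolding gap_intervals_iff[OF K] using a b by blast
  then have "ennreal (dist (\<gamma> a) (\<gamma> b)) \<le> fragment_gap K \<gamma>"
    by (rule dist_le_fragment_gap)
  moreover have "s' - s \<le> dist (\<gamma> a) (\<gamma> b)"
    using a(2) b(2) dist_triangle[of x "\<gamma> b" "\<gamma> a"] by linarith
  ultimately show ?thesis
    by (meson ennreal_leI order_trans)
qed

text \<open>Among \<open>N > 1 / \<epsilon>\<close> annuli of equal width around \<open>x\<close>, one has less than the fraction \<open>\<epsilon>\<close> of the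
  measure, and jumping across it costs \<open>dist x y / N\<close>.\<close>

lemma fragment_connected_pair_gap_gt:
  fixes \<mu> :: "'a::polish_space measure" and \<delta> \<epsilon> C :: real
  assumes mm: "metric_measure_space \<mu>" and conn: "fragment_connected_pair \<mu> C \<delta> \<epsilon> x y"
    and xy: "0 < dist x y" and C: "1 \<le> C" and \<epsilon>: "0 < \<epsilon>" "\<epsilon> < 1"
  shows "\<epsilon> / 2 < \<delta>"
proof -
  have sets: "sets \<mu> = sets borel"
    and pos: "\<And>x r. r > 0 \<Longrightarrow> 0 < emeasure \<mu> (ball x r) \<and> emeasure \<mu> (ball x r) < \<infinity>"
    using mm unfolding metric_measure_space_def radon_measure_def by blast+
  define r where "r = dist x y"
  have r: "0 < r" "r \<le> C * r"
    using xy C mult_right_mono[of 1 C r] by (auto simp: r_def)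
  define N where "N = nat \<lfloor>1 / \<epsilon>\<rfloor> + 1"
  have N: "1 / \<epsilon> < N" "N \<le> 1 / \<epsilon> + 1" "0 < N"
    using \<epsilon> unfolding N_def by (auto simp: floor_less_iff) linarith+
  have N\<epsilon>: "1 < N * \<epsilon>" "N * \<epsilon> < 2"
  proof -
    show "1 < N * \<epsilon>"
      using N(1) \<epsilon> by (simp add: field_simps)
    have "N * \<epsilon> \<le> (1 / \<epsilon> + 1) * \<epsilon>"
      using N(2) \<epsilon> by (intro mult_right_mono) auto
    then show "N * \<epsilon> < 2"
      using \<epsilon> by (simp add: distrib_right)
  qed
  define h where "h = r / N"
  have h: "0 < h" "N * h = r"
    using r N by (auto simp: h_def)
  define B where "B = ball x (C * r)"
  obtain m where m: "emeasure \<mu> B = ennreal m" "0 < m"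
    using pos[of "C * r" x] r unfolding B_def by (cases "emeasure \<mu> (ball x (C * r))") auto
  define A where "A i = ball x (Suc i * h) - ball x (i * h)" for i :: nat
  have "\<exists>i<N. emeasure \<mu> (A i \<inter> B) < ennreal \<epsilon> * emeasure \<mu> B"
  proof (rule ccontr)
    assume no: "\<not> ?thesis"
    have "disjoint_family A"
    proof -
      have "A i \<inter> A j = {}" if "i < j" for i j
      proof -
        have "Suc i * h \<le> j * h"
          using that h(1) by (intro mult_right_mono) auto
        then show ?thesis
          by (force simp: A_def)
      qed
      then show ?thesis
        unfolding disjoint_family_on_def by (metis Int_commute linorder_neqE_nat)
    qed
    then have disj: "disjoint_family_on (\<lambda>i. A i \<inter> B) {..<N}"
      unfolding disjoint_family_on_def by blast
    have "ennreal (N * (\<epsilon> * m)) = (\<Sum>i<N. ennreal \<epsilon> * emeasure \<mu> B)"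
      using \<epsilon> m by (simp add: ennreal_mult ennreal_of_nat_eq_real_of_nat)
    also have "\<dots> \<le> (\<Sum>i<N. emeasure \<mu> (A i \<inter> B))"
      using no by (intro sum_mono) (meson lessThan_iff not_less)
    also have "\<dots> = emeasure \<mu> (\<Union>i<N. A i \<inter> B)"
      by (rule sum_emeasure) (use disj in \<open>auto simp: sets A_def B_def\<close>)
    also have "\<dots> \<le> ennreal m"
      unfolding m(1)[symmetric] by (rule emeasure_mono) (auto simp: sets B_def)
    finally have "N * \<epsilon> * m \<le> 1 * m"
      using m(2) by (simp add: mult.assoc)
    then have "N * \<epsilon> \<le> 1"
      using m(2) by (simp only: mult_le_cancel_right_pos)
    then show False
      using N\<epsilon>(1) by simp
  qed
  then obtain i where i: "i < N" "emeasure \<mu> (A i \<inter> B) < ennreal \<epsilon> * emeasure \<mu> B"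
    by blast
  have "A i \<in> sets borel"
    by (auto simp: A_def)
  then obtain K \<gamma> where frag: "curve_fragment K \<gamma>" and ends: "\<gamma> (Inf K) = x" "\<gamma> (Sup K) = y"
    and gap: "fragment_gap K \<gamma> < ennreal (\<delta> * r)" and av: "fragment_avoids (A i) K \<gamma>"
    using conn i(2) unfolding fragment_connected_pair_def fragment_connects_def
      fragment_avoids_def B_def r_def by blast
  have "ennreal (Suc i * h - i * h) \<le> fragment_gap K \<gamma>"
  proof (rule fragment_gap_ge_annulus[OF frag ends(1)])
    have "Suc i * h \<le> N * h"
      using i(1) h(1) by (intro mult_right_mono) auto
    then show "Suc i * h \<le> dist x (\<gamma> (Sup K))"
      using h(2) ends(2) by (simp add: r_def)
    show "0 \<le> i * h" "i * h < Suc i * h"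
      using h(1) by (auto simp: algebra_simps)
  qed (use av in \<open>simp add: A_def\<close>)
  also note gap
  finally have "h < \<delta> * r"
    using h(1) by (simp add: ennreal_less_iff algebra_simps)
  then have "h < \<delta> * N * h"
    using h(2) by (simp add: mult.assoc)
  then have "1 < \<delta> * N"
    using h(1) by simp
  moreover have "\<epsilon> / 2 * N < 1"
    using N\<epsilon>(2) by (simp add: mult.commute)
  ultimately have "\<epsilon> / 2 * N < \<delta> * N"
    by linarith
  then show ?thesis
    by (rule mult_right_less_imp_less) simp
qed

section \<open>Fine connectivity\<close>

theorem theorem1p8:
  fixes \<mu> :: "'a::polish_space measure"
    and \<delta> \<epsilon> r0 C D M :: real
  assumes "0 < \<delta>" "\<delta> < 1" "0 < \<epsilon>" "\<epsilon> < 1" "0 < r0" "1 \<le> C" "1 \<le> D"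
    and "metric_measure_space \<mu>"
    and "fragment_connected_space \<mu> C \<delta> \<epsilon> r0"
    and "doubling \<mu> D r0"
    and M_def: "M = 2 * D powr (- log 2 (1 - \<delta>) + 4)"
  shows "\<exists>\<alpha> C1 C2. 0 < \<alpha> \<and> 1 \<le> C1 \<and> 1 \<le> C2 \<and>
           locally_finely_connected \<mu> \<alpha> (r0 / (8 * C1)) C1 C2 \<and>
           \<alpha> = ln \<delta> / ln (\<epsilon> / (2 * M)) \<and> C1 = C / (1 - \<delta>) \<and> C2 = 2 * M / \<epsilon>"
proof -
  define q where "q = \<epsilon> / (2 * M)"
  define \<alpha> where "\<alpha> = ln \<delta> / ln q"
  define C1 where "C1 = C / (1 - \<delta>)"
  have "log 2 (1 - \<delta>) < 0"
    using assms(1,2) by simp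
  then have "1 \<le> D powr (- log 2 (1 - \<delta>) + 4)"
    using assms(7) by (intro ge_one_powr_ge_zero) auto
  then have M: "2 \<le> M"
    by (simp add: M_def)
  have q: "0 < q" "q < 1" "q < \<epsilon> / 2" "2 * M / \<epsilon> = 1 / q"
    using M assms(3,4) by (auto simp: q_def field_simps)
  have \<alpha>: "0 < \<alpha>" "\<delta> = q powr \<alpha>"
    using q assms(1,2) by (auto simp: \<alpha>_def powr_def divide_neg_neg)
  have C1: "1 \<le> C1"
    using assms(1,2,6) by (simp add: C1_def pos_le_divide_eq)
  have "locally_finely_connected \<mu> \<alpha> (r0 / (8 * C1)) C1 (1 / q)"
    unfolding locally_finely_connected_def fragment_connected_space_def
      fragment_connected_pair_def
  proof (intro allI impI ballI, elim conjE)
    fix \<tau> :: real and x y :: 'a and E :: "'a set"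
    assume \<tau>: "0 < \<tau>" "\<tau> < 1" and xy: "0 < dist x y" "dist x y \<le> r0 / (8 * C1)"
      and E: "E \<in> sets borel"
      and small: "emeasure \<mu> (E \<inter> ball x (C1 * dist x y))
        < ennreal \<tau> * emeasure \<mu> (ball x (C1 * dist x y))"
    have "r0 / (8 * C1) \<le> r0"
      using C1 assms(5) by (simp add: field_simps)
    then have "fragment_connected_pair \<mu> C \<delta> \<epsilon> x y"
      using assms(9) xy unfolding fragment_connected_space_def by auto
    then have "\<epsilon> / 2 < \<delta>"
      using fragment_connected_pair_gap_gt assms xy by blast
    then have q\<delta>: "q < \<delta>"
      using q(3) by linarith
    define t where "t = ln \<tau> / ln q"
    have t: "0 < t" "\<tau> = q powr t"
      using q \<tau> by (auto simp: t_def powr_def divide_neg_neg)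
    (* Here tau = q powr t, and the iteration yields the densities q ^ n only.  Rounding t down
       loses at most one factor delta in the gap, which the constant 1 / q absorbs as q < delta. *)
    define n where "n = nat \<lfloor>t\<rfloor>"
    have n: "n \<le> t" "t - 1 < n"
      using t(1) unfolding n_def by linarith+
    have "\<tau> \<le> q powr n"
      unfolding t(2) using q n(1) by (intro powr_mono') auto
    then have \<tau>_le: "\<tau> \<le> q ^ n"
      using q by (simp add: powr_realpow)
    have \<delta>_less: "\<delta> ^ n < 1 / q * \<tau> powr \<alpha>"
    proof -
      have "\<delta> ^ n = \<delta> powr n"
        using assms(1) by (simp add: powr_realpow)
      also have "\<dots> < \<delta> powr (t - 1)"
        using assms(1,2) n(2) by (simp add: powr_def)
      also have "\<dots> = 1 / \<delta> * \<delta> powr t"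
        using assms(1) by (simp add: powr_diff)
      also have "\<dots> \<le> 1 / q * \<delta> powr t"
        using q q\<delta> by (intro mult_right_mono divide_left_mono) auto
      also have "\<delta> powr t = \<tau> powr \<alpha>"
        by (simp add: t(2) \<alpha>(2) powr_powr mult.commute)
      finally show ?thesis .
    qed
    have "joined_if_sparse \<mu> (r0 / (8 * C1)) C1 (q ^ n) (\<delta> ^ n)"
      unfolding q_def C1_def
      by (rule joined_if_sparse_power[OF assms(8,10,7,9,1,2,3,6) M_def])
        (use q in \<open>simp add: q_def\<close>)
    moreover have "emeasure \<mu> (E \<inter> ball x (C1 * dist x y))
        < ennreal (q ^ n) * emeasure \<mu> (ball x (C1 * dist x y))"
      using small mult_right_mono[OF ennreal_leI[OF \<tau>_le]] by (rule order_less_le_trans) simp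
    ultimately have "joined_on 0 1 E x y (C1 * dist x y) (\<delta> ^ n * dist x y)"
      using xy E unfolding joined_if_sparse_def by blast
    then obtain K \<gamma> where *: "curve_fragment K \<gamma>" "fragment_connects K \<gamma> x y"
      "fragment_len K \<gamma> \<le> ennreal (C1 * dist x y)"
      "fragment_gap K \<gamma> \<le> ennreal (\<delta> ^ n * dist x y)" "fragment_avoids E K \<gamma>"
      unfolding joined_on_def by blast
    have "ennreal (\<delta> ^ n * dist x y) < ennreal (1 / q * \<tau> powr \<alpha> * dist x y)"
      using \<delta>_less xy(1) q(1) \<tau>(1)
      by (intro ennreal_lessI mult_strict_right_mono) simp_all
    then have "fragment_gap K \<gamma> < ennreal (1 / q * \<tau> powr \<alpha> * dist x y)"
      using *(4) by (rule order_le_less_trans[rotated])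
    then show "\<exists>K \<gamma>. curve_fragment K \<gamma> \<and> fragment_connects K \<gamma> x y \<and>
        fragment_len K \<gamma> \<le> ennreal (C1 * dist x y) \<and>
        fragment_gap K \<gamma> < ennreal (1 / q * \<tau> powr \<alpha> * dist x y) \<and>
        {t\<in>K. \<gamma> t \<in> E} \<subseteq> {Inf K, Sup K}"
      using * unfolding fragment_avoids_def by blast
  qed
  moreover have "1 \<le> 1 / q"
    using q by simp
  ultimately show ?thesis
    using \<alpha>(1) C1 unfolding q(4) \<alpha>_def q_def C1_def by blast
qed

end
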